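(* Let $n\ge1$. The spinor representation $V_q(n)$ of $\mathrm{U}_q(\mathfrak{osp}(1|2n),\Theta_1)$ is irreducible, with highest weight vector $|0\rangle$ of weight $(1,\dots,1,\sqrt{-1}\,q^{1/2})$ (with $n-1$ entries equal to $1$). Furthermore, the dimension of $V_q(n)$ (over $\mathbb{C}(q^{1/2})$) is $2^n$.
   Context: $q$ is an indeterminate over $\mathbb{C}$; all algebras and vector spaces are over $\mathbb{C}(q^{1/2})$; $\sqrt{-1}\in\mathbb{C}$ is the imaginary unit. For a superalgebra, $[x]\in\mathbb{Z}_2$ denotes the parity of a homogeneous element $x$. **The quantum supergroup $\mathrm{U}_q(\mathfrak{osp}(1|2n),\Theta_1)$, $\Theta_1=\{n\}$.** Let $A=(a_{ij})_{1\le i,j\le n}$ be given by $a_{ii}=2$; $a_{i,i+1}=-1$ for $1\le i\le n-1$; $a_{i+1,i}=-1$ for $1\le i\le n-2$; $a_{n,n-1}=-2$ (if $n\geq 2$); all other entries $0$. Let $d_i=1$ for $i<n$, $d_n=\tfrac12$, and $q_i=q^{d_i}$. $\mathrm{U}_q(\mathfrak{osp}(1|2n),\Theta_1)$ is the associative superalgebra generated by $e_i,f_i,k_i^{\pm1}$ ($1\le i\le n$), with $e_n,f_n$ odd and all other generators even, subject to - $k_ik_i^{-1}=k_i^{-1}k_i=1$, $k_ik_j=k_jk_i$; - $k_ie_jk_i^{-1}=q_i^{a_{ij}}e_j$, $k_if_jk_i^{-1}=q_i^{-a_{ij}}f_j$; - $e_if_j-(-1)^{[e_i][f_j]}f_je_i=\delta_{ij}\dfrac{k_i-k_i^{-1}}{q-q^{-1}}$;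 - $(\mathrm{Ad}_{e_i})^{1-a_{ij}}(e_j)=(\mathrm{Ad}_{f_i})^{1-a_{ij}}(f_j)=0$ for $i\ne j$, where, for homogeneous $x$, $\mathrm{Ad}_{e_i}(x)=e_ix-(-1)^{[e_i][x]}k_ixk_i^{-1}e_i$ and $\mathrm{Ad}_{f_i}(x)=f_ix-(-1)^{[f_i][x]}k_i^{-1}xk_if_i$. **The deformed Clifford algebra $\mathrm{Cl}_q(n)$** is the associative algebra generated by $\psi_i,\psi_i^\dagger,v_i^{\pm1}$ ($1\le i\le n$) subject to - $v_iv_j=v_jv_i$, $v_iv_i^{-1}=v_i^{-1}v_i=1$; - $v_i\psi_jv_i^{-1}=q^{\delta_{ij}}\psi_j$, $v_i\psi_j^\dagger v_i^{-1}=q^{-\delta_{ij}}\psi_j^\dagger$; - $\psi_i\psi_j+\psi_j\psi_i=\psi_i^\dagger\psi_j^\dagger+\psi_j^\dagger\psi_i^\dagger=0$ for all $i,j$; - $\psi_i\psi_j^\dagger+\psi_j^\dagger\psi_i=0$ for $i\ne j$; - $\psi_i\psi_i^\dagger+q\psi_i^\dagger\psi_i=v_i^{-1}$, $\psi_i\psi_i^\dagger+q^{-1}\psi_i^\dagger\psi_i=v_i$. **Fock space.** $V_q(n)$ is the $\mathrm{Cl}_q(n)$-module with basis $|\mathbf r\rangle=(\psi_1^\dagger)^{r_1}\cdots(\psi_n^\dagger)^{r_n}|0\rangle$, $\mathbf r=(r_1,\dots,r_n)\in\{0,1\}^n$, where the vacuum vector $|0\rangle$ satisfies $\psi_i|0\rangle=0$,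 $v_i|0\rangle=|0\rangle$ for all $i$. Explicitly, $v_i|\mathbf r\rangle=q^{-r_i}|\mathbf r\rangle$, $\psi_i|\mathbf r\rangle=(-1)^{r_1+\cdots+r_{i-1}}|\mathbf r-\mathbf e_i\rangle$, $\psi_i^\dagger|\mathbf r\rangle=(-1)^{r_1+\cdots+r_{i-1}}|\mathbf r+\mathbf e_i\rangle$, where $\mathbf e_i$ is the $i$-th unit vector and $|\mathbf r\pm\mathbf e_i\rangle=0$ if $r_i\pm1\notin\{0,1\}$. **Spinor representation.** $V_q(n)$ is made into a $\mathrm{U}_q(\mathfrak{osp}(1|2n),\Theta_1)$-module through the algebra homomorphism $\pi:\mathrm{U}_q(\mathfrak{osp}(1|2n),\Theta_1)\to\mathrm{Cl}_q(n)$ with $e_i\mapsto\psi_i\psi_{i+1}^\dagger$, $f_i\mapsto\psi_{i+1}\psi_i^\dagger$, $k_i\mapsto v_iv_{i+1}^{-1}$ for $1\le i\le n-1$, and $e_n\mapsto\sqrt{-1}(q^{1/2}-q^{-1/2})^{-1}\psi_n$, $f_n\mapsto\psi_n^\dagger$, $k_n\mapsto\sqrt{-1}q^{1/2}v_n$. A highest weight vector of weight $(\lambda_1,\dots,\lambda_n)$ is a nonzero vector $w$ with $e_iw=0$ and $k_iw=\lambda_iw$ for all $i$. *)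

theory Defs
  imports
    Complex_Main
    "HOL-Library.Poly_Mapping"
    "HOL-Library.FuncSet"
    "HOL-Computational_Algebra.Polynomial"
    "HOL-Computational_Algebra.Fraction_Field"
    "HOL-Algebra.QuotRing"
    "HOL-Algebra.Module"
begin

section \<open>Finitely supported functions as vectors\<close>

definition pm_scale :: "'k::field \<Rightarrow> ('b \<Rightarrow>\<^sub>0 'k) \<Rightarrow> ('b \<Rightarrow>\<^sub>0 'k)" where
  "pm_scale c v = Poly_Mapping.map ((*) c) v"

lemma lookup_pm_scale [simp]: "Poly_Mapping.lookup (pm_scale c v) b = c * Poly_Mapping.lookup v b"
  by (simp add: pm_scale_def Poly_Mapping.map.rep_eq when_def)

global_interpretation pm: vector_space pm_scale
  by unfold_locales (auto intro!: poly_mapping_eqI simp: lookup_add algebra_simps)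


section \<open>Associative algebras by generators and relations\<close>

text \<open>
  An associative unital algebra over the field \<open>'k\<close> is represented by a record of type
  \<open>('k, 'a) module\<close>: a ring together with a scalar multiplication \<open>\<odot>\<close>. (The record
  type is used without the locale of the same name, which would require commutativity.)
\<close>

definition algebra_hom ::
    "('k::field, 'a) module \<Rightarrow> ('k, 'b) module \<Rightarrow> ('a \<Rightarrow> 'b) set" where
  "algebra_hom A B = {h \<in> ring_hom A B.
     \<forall>c. \<forall>x\<in>carrier A. h (c \<odot>\<^bsub>A\<^esub> x) = c \<odot>\<^bsub>B\<^esub> h x}"

text \<open>Words under concatenation, written additively so that the product of finitely
  supported functions is the convolution product.\<close>

datatype 'g word = Word (letters: "'g list")

instantiation word :: (type) monoid_add
begin
definition "0 = Word []"
definition "u + w = Word (letters u @ letters w)"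
instance by standard (auto simp: zero_word_def plus_word_def)
end

type_synonym ('g, 'k) free_alg = "'g word \<Rightarrow>\<^sub>0 'k"

definition gen :: "'g \<Rightarrow> ('g, 'k::field) free_alg" where
  "gen g = Poly_Mapping.single (Word [g]) 1"

definition free_algebra :: "'g set \<Rightarrow> ('k::field, ('g, 'k) free_alg) module" where
  "free_algebra X =
     \<lparr>carrier = {p. \<forall>w\<in>Poly_Mapping.keys p. set (letters w) \<subseteq> X},
      mult = (*), one = 1, zero = 0, add = (+), smult = pm_scale\<rparr>"

definition rel_ideal ::
    "'g set \<Rightarrow> (('g, 'k::field) free_alg \<Rightarrow> ('g, 'k) free_alg \<Rightarrow> bool) \<Rightarrow> ('g, 'k) free_alg set"
  where "rel_ideal X R = Idl\<^bsub>free_algebra X\<^esub> {a - b | a b. R a b}"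

text \<open>The associative algebra generated by \<open>X\<close> subject to the relations \<open>a = b\<close> for
  \<open>R a b\<close>: the quotient of the free algebra by a two-sided ideal.\<close>

definition presented_algebra ::
    "'g set \<Rightarrow> (('g, 'k::field) free_alg \<Rightarrow> ('g, 'k) free_alg \<Rightarrow> bool) \<Rightarrow>
      ('k, ('g, 'k) free_alg set) module" where
  "presented_algebra X R = (let A = free_algebra X; I = rel_ideal X R in
     \<lparr>carrier = carrier (A Quot I), mult = mult (A Quot I), one = one (A Quot I),
      zero = zero (A Quot I), add = add (A Quot I),
      smult = (\<lambda>c Y. \<Union>y\<in>Y. I +>\<^bsub>A\<^esub> (c \<odot>\<^bsub>A\<^esub> y))\<rparr>)"

definition gen_class ::
    "'g set \<Rightarrow> (('g, 'k::field) free_alg \<Rightarrow> ('g, 'k) free_alg \<Rightarrow> bool) \<Rightarrow> 'g \<Rightarrow> ('g, 'k) free_alg set"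
  where "gen_class X R g = rel_ideal X R +>\<^bsub>free_algebra X\<^esub> gen g"

definition free_eval ::
    "('k::field, 'b) module \<Rightarrow> ('g \<Rightarrow> 'b) \<Rightarrow> ('g, 'k) free_alg \<Rightarrow> 'b" where
  "free_eval B \<phi> p = finsum B
     (\<lambda>w. Poly_Mapping.lookup p w \<odot>\<^bsub>B\<^esub> foldr (\<lambda>g y. \<phi> g \<otimes>\<^bsub>B\<^esub> y) (letters w) \<one>\<^bsub>B\<^esub>)
     (Poly_Mapping.keys p)"

text \<open>The algebra homomorphism from a presented algebra to \<open>B\<close> with \<open>g \<mapsto> \<phi> g\<close> on
  generators, provided that \<open>\<phi>\<close> respects the relations; \<open>free_eval\<close> is then constant
  on cosets.\<close>

definition induced_hom ::
    "('k::field, 'b) module \<Rightarrow> ('g \<Rightarrow> 'b) \<Rightarrow> ('g, 'k) free_alg set \<Rightarrow> 'b" where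
  "induced_hom B \<phi> Y = the_elem (free_eval B \<phi> ` Y)"


section \<open>Representations\<close>

definition End_algebra ::
    "('b \<Rightarrow>\<^sub>0 'k::field) set \<Rightarrow> ('k, ('b \<Rightarrow>\<^sub>0 'k) \<Rightarrow> ('b \<Rightarrow>\<^sub>0 'k)) module" where
  "End_algebra V =
     \<lparr>carrier = {T \<in> V \<rightarrow>\<^sub>E V. (\<forall>v\<in>V. \<forall>w\<in>V. T (v + w) = T v + T w) \<and>
                               (\<forall>c. \<forall>v\<in>V. T (pm_scale c v) = pm_scale c (T v))},
      mult = compose V, one = (\<lambda>v\<in>V. v), zero = (\<lambda>v\<in>V. 0),
      add = (\<lambda>S T. \<lambda>v\<in>V. S v + T v), smult = (\<lambda>c T. \<lambda>v\<in>V. pm_scale c (T v))\<rparr>"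

definition representation ::
    "('k::field, 'a) module \<Rightarrow> ('b \<Rightarrow>\<^sub>0 'k) set \<Rightarrow> ('a \<Rightarrow> ('b \<Rightarrow>\<^sub>0 'k) \<Rightarrow> ('b \<Rightarrow>\<^sub>0 'k)) \<Rightarrow> bool"
  where "representation A V \<rho> \<longleftrightarrow> pm.subspace V \<and> \<rho> \<in> algebra_hom A (End_algebra V)"

text \<open>All invariant subspaces are considered, not only those compatible with some
  \<open>\<int>/2\<close>-grading.\<close>

definition irreducible_representation ::
    "('k::field, 'a) module \<Rightarrow> ('b \<Rightarrow>\<^sub>0 'k) set \<Rightarrow> ('a \<Rightarrow> ('b \<Rightarrow>\<^sub>0 'k) \<Rightarrow> ('b \<Rightarrow>\<^sub>0 'k)) \<Rightarrow> bool"
  where "irreducible_representation A V \<rho> \<longleftrightarrow>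
     representation A V \<rho> \<and> V \<noteq> {0} \<and>
     (\<forall>W. pm.subspace W \<and> W \<subseteq> V \<and> (\<forall>a\<in>carrier A. \<forall>w\<in>W. \<rho> a w \<in> W) \<longrightarrow> W = {0} \<or> W = V)"


section \<open>The ground field\<close>

text \<open>\<open>\<complex>(q\<^sup>1\<^sup>/\<^sup>2)\<close> is the field of rational functions in the variable \<open>qh = q\<^sup>1\<^sup>/\<^sup>2\<close>.\<close>

type_synonym qfield = "complex poly fract"

definition qh :: qfield where "qh = Fract [:0, 1:] 1"

definition q :: qfield where "q = qh ^ 2"

definition iu :: qfield where "iu = Fract [:\<i>:] 1"


section \<open>The quantum supergroup of type osp(1|2n)\<close>

datatype osp_gen = E nat | F nat | K nat | Kinv nat

type_synonym osp_free = "(osp_gen, qfield) free_alg"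

definition osp_gens :: "nat \<Rightarrow> osp_gen set" where
  "osp_gens n = (\<Union>i\<in>{1..n}. {E i, F i, K i, Kinv i})"

definition cartan :: "nat \<Rightarrow> nat \<Rightarrow> nat \<Rightarrow> int" where
  "cartan n i j =
     (if i = j then 2
      else if j = i + 1 then -1
      else if i = j + 1 then (if i = n then -2 else -1)
      else 0)"

text \<open>\<open>q\<^sub>i = q\<close> to the power \<open>d\<^sub>i\<close>, where \<open>d\<^sub>n = 1/2\<close> and \<open>d\<^sub>i = 1\<close> for \<open>i < n\<close>.\<close>

definition qi :: "nat \<Rightarrow> nat \<Rightarrow> qfield" where
  "qi n i = (if i = n then qh else q)"

fun gen_parity :: "nat \<Rightarrow> osp_gen \<Rightarrow> nat" where
  "gen_parity n (E i) = (if i = n then 1 else 0)"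
| "gen_parity n (F i) = (if i = n then 1 else 0)"
| "gen_parity n (K i) = 0"
| "gen_parity n (Kinv i) = 0"

definition homogeneous :: "nat \<Rightarrow> nat \<Rightarrow> osp_free \<Rightarrow> bool" where
  "homogeneous n p x \<longleftrightarrow>
     (\<forall>w\<in>Poly_Mapping.keys x. sum_list (map (gen_parity n) (letters w)) mod 2 = p)"

text \<open>The parity of a homogeneous element of the free superalgebra. It is meaningless on
  other elements; the element \<open>0\<close>, homogeneous of both parities, gets parity \<open>0\<close>.\<close>

definition parity :: "nat \<Rightarrow> osp_free \<Rightarrow> nat" where
  "parity n x = (LEAST p. homogeneous n p x)"

definition Ad_E :: "nat \<Rightarrow> nat \<Rightarrow> osp_free \<Rightarrow> osp_free" where
  "Ad_E n i x = gen (E i) * x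
     - (- 1) ^ (parity n (gen (E i)) * parity n x) * (gen (K i) * x * gen (Kinv i) * gen (E i))"

definition Ad_F :: "nat \<Rightarrow> nat \<Rightarrow> osp_free \<Rightarrow> osp_free" where
  "Ad_F n i x = gen (F i) * x
     - (- 1) ^ (parity n (gen (F i)) * parity n x) * (gen (Kinv i) * x * gen (K i) * gen (F i))"

inductive osp_rel :: "nat \<Rightarrow> osp_free \<Rightarrow> osp_free \<Rightarrow> bool" for n where
  K_Kinv: "i \<in> {1..n} \<Longrightarrow> osp_rel n (gen (K i) * gen (Kinv i)) 1"
| Kinv_K: "i \<in> {1..n} \<Longrightarrow> osp_rel n (gen (Kinv i) * gen (K i)) 1"
| K_K: "i \<in> {1..n} \<Longrightarrow> j \<in> {1..n} \<Longrightarrow>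
    osp_rel n (gen (K i) * gen (K j)) (gen (K j) * gen (K i))"
| K_E: "i \<in> {1..n} \<Longrightarrow> j \<in> {1..n} \<Longrightarrow>
    osp_rel n (gen (K i) * gen (E j) * gen (Kinv i))
      (pm_scale (qi n i powi cartan n i j) (gen (E j)))"
| K_F: "i \<in> {1..n} \<Longrightarrow> j \<in> {1..n} \<Longrightarrow>
    osp_rel n (gen (K i) * gen (F j) * gen (Kinv i))
      (pm_scale (qi n i powi (- cartan n i j)) (gen (F j)))"
| E_F: "i \<in> {1..n} \<Longrightarrow> j \<in> {1..n} \<Longrightarrow>
    osp_rel n
      (gen (E i) * gen (F j)
        - (- 1) ^ (parity n (gen (E i)) * parity n (gen (F j))) * (gen (F j) * gen (E i)))
      (if i = j then pm_scale (1 / (q - inverse q)) (gen (K i) - gen (Kinv i)) else 0)"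
| Serre_E: "i \<in> {1..n} \<Longrightarrow> j \<in> {1..n} \<Longrightarrow> i \<noteq> j \<Longrightarrow>
    osp_rel n ((Ad_E n i ^^ nat (1 - cartan n i j)) (gen (E j))) 0"
| Serre_F: "i \<in> {1..n} \<Longrightarrow> j \<in> {1..n} \<Longrightarrow> i \<noteq> j \<Longrightarrow>
    osp_rel n ((Ad_F n i ^^ nat (1 - cartan n i j)) (gen (F j))) 0"

definition Uq_osp :: "nat \<Rightarrow> (qfield, osp_free set) module" where
  "Uq_osp n = presented_algebra (osp_gens n) (osp_rel n)"

definition osp_class :: "nat \<Rightarrow> osp_gen \<Rightarrow> osp_free set" where
  "osp_class n = gen_class (osp_gens n) (osp_rel n)"

definition highest_weight_vector ::
    "nat \<Rightarrow> ('b \<Rightarrow>\<^sub>0 qfield) set \<Rightarrow> (osp_free set \<Rightarrow> ('b \<Rightarrow>\<^sub>0 qfield) \<Rightarrow> ('b \<Rightarrow>\<^sub>0 qfield)) \<Rightarrow>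
      (nat \<Rightarrow> qfield) \<Rightarrow> ('b \<Rightarrow>\<^sub>0 qfield) \<Rightarrow> bool" where
  "highest_weight_vector n V \<rho> lam w \<longleftrightarrow> w \<in> V \<and> w \<noteq> 0 \<and>
     (\<forall>i\<in>{1..n}. \<rho> (osp_class n (E i)) w = 0 \<and>
                  \<rho> (osp_class n (K i)) w = pm_scale (lam i) w)"


section \<open>The deformed Clifford algebra\<close>

text \<open>\<open>Psid\<close> stands for \<open>\<psi>\<^sup>\<dagger>\<close>.\<close>

datatype cl_gen = Psi nat | Psid nat | V nat | Vinv nat

type_synonym cl_free = "(cl_gen, qfield) free_alg"

definition cl_gens :: "nat \<Rightarrow> cl_gen set" where
  "cl_gens n = (\<Union>i\<in>{1..n}. {Psi i, Psid i, V i, Vinv i})"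

inductive cl_rel :: "nat \<Rightarrow> cl_free \<Rightarrow> cl_free \<Rightarrow> bool" for n where
  V_V: "i \<in> {1..n} \<Longrightarrow> j \<in> {1..n} \<Longrightarrow>
    cl_rel n (gen (V i) * gen (V j)) (gen (V j) * gen (V i))"
| V_Vinv: "i \<in> {1..n} \<Longrightarrow> cl_rel n (gen (V i) * gen (Vinv i)) 1"
| Vinv_V: "i \<in> {1..n} \<Longrightarrow> cl_rel n (gen (Vinv i) * gen (V i)) 1"
| V_Psi: "i \<in> {1..n} \<Longrightarrow> j \<in> {1..n} \<Longrightarrow>
    cl_rel n (gen (V i) * gen (Psi j) * gen (Vinv i))
      (pm_scale (if i = j then q else 1) (gen (Psi j)))"
| V_Psid: "i \<in> {1..n} \<Longrightarrow> j \<in> {1..n} \<Longrightarrow>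
    cl_rel n (gen (V i) * gen (Psid j) * gen (Vinv i))
      (pm_scale (if i = j then inverse q else 1) (gen (Psid j)))"
| Psi_Psi: "i \<in> {1..n} \<Longrightarrow> j \<in> {1..n} \<Longrightarrow>
    cl_rel n (gen (Psi i) * gen (Psi j) + gen (Psi j) * gen (Psi i)) 0"
| Psid_Psid: "i \<in> {1..n} \<Longrightarrow> j \<in> {1..n} \<Longrightarrow>
    cl_rel n (gen (Psid i) * gen (Psid j) + gen (Psid j) * gen (Psid i)) 0"
| Psi_Psid: "i \<in> {1..n} \<Longrightarrow> j \<in> {1..n} \<Longrightarrow> i \<noteq> j \<Longrightarrow>
    cl_rel n (gen (Psi i) * gen (Psid j) + gen (Psid j) * gen (Psi i)) 0"
| Psi_Psid_q: "i \<in> {1..n} \<Longrightarrow>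
    cl_rel n (gen (Psi i) * gen (Psid i) + pm_scale q (gen (Psid i) * gen (Psi i)))
      (gen (Vinv i))"
| Psi_Psid_q_inv: "i \<in> {1..n} \<Longrightarrow>
    cl_rel n (gen (Psi i) * gen (Psid i) + pm_scale (inverse q) (gen (Psid i) * gen (Psi i)))
      (gen (V i))"

definition Cl :: "nat \<Rightarrow> (qfield, cl_free set) module" where
  "Cl n = presented_algebra (cl_gens n) (cl_rel n)"

definition cl_class :: "nat \<Rightarrow> cl_gen \<Rightarrow> cl_free set" where
  "cl_class n = gen_class (cl_gens n) (cl_rel n)"


section \<open>Fock space and the spinor representation\<close>

type_synonym fock = "(nat \<Rightarrow> nat) \<Rightarrow>\<^sub>0 qfield"

definition occupation :: "nat \<Rightarrow> (nat \<Rightarrow> nat) set" where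
  "occupation n = ({1..n} \<rightarrow>\<^sub>E {0, 1})"

definition fock_space :: "nat \<Rightarrow> fock set" where
  "fock_space n = {v. Poly_Mapping.keys v \<subseteq> occupation n}"

definition ket :: "(nat \<Rightarrow> nat) \<Rightarrow> fock" where
  "ket r = Poly_Mapping.single r 1"

definition vacuum :: "nat \<Rightarrow> fock" where
  "vacuum n = ket (\<lambda>i\<in>{1..n}. 0)"

definition linear_extension :: "nat \<Rightarrow> ((nat \<Rightarrow> nat) \<Rightarrow> fock) \<Rightarrow> fock \<Rightarrow> fock" where
  "linear_extension n f =
     (\<lambda>v\<in>fock_space n. \<Sum>r\<in>Poly_Mapping.keys v. pm_scale (Poly_Mapping.lookup v r) (f r))"

fun cl_action :: "nat \<Rightarrow> cl_gen \<Rightarrow> fock \<Rightarrow> fock" where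
  "cl_action n (V i) = linear_extension n (\<lambda>r. pm_scale (inverse q ^ r i) (ket r))"
| "cl_action n (Vinv i) = linear_extension n (\<lambda>r. pm_scale (q ^ r i) (ket r))"
| "cl_action n (Psi i) = linear_extension n (\<lambda>r.
     if r i = 1 then pm_scale ((- 1) ^ (\<Sum>j\<in>{1..<i}. r j)) (ket (r(i := 0))) else 0)"
| "cl_action n (Psid i) = linear_extension n (\<lambda>r.
     if r i = 0 then pm_scale ((- 1) ^ (\<Sum>j\<in>{1..<i}. r j)) (ket (r(i := 1))) else 0)"

definition fock_rep :: "nat \<Rightarrow> cl_free set \<Rightarrow> fock \<Rightarrow> fock" where
  "fock_rep n = induced_hom (End_algebra (fock_space n)) (cl_action n)"

fun pi_gen :: "nat \<Rightarrow> osp_gen \<Rightarrow> cl_free set" where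
  "pi_gen n (E i) =
     (if i = n then (iu / (qh - inverse qh)) \<odot>\<^bsub>Cl n\<^esub> cl_class n (Psi n)
      else cl_class n (Psi i) \<otimes>\<^bsub>Cl n\<^esub> cl_class n (Psid (i + 1)))"
| "pi_gen n (F i) =
     (if i = n then cl_class n (Psid n)
      else cl_class n (Psi (i + 1)) \<otimes>\<^bsub>Cl n\<^esub> cl_class n (Psid i))"
| "pi_gen n (K i) =
     (if i = n then (iu * qh) \<odot>\<^bsub>Cl n\<^esub> cl_class n (V n)
      else cl_class n (V i) \<otimes>\<^bsub>Cl n\<^esub> cl_class n (Vinv (i + 1)))"
| "pi_gen n (Kinv i) =
     (if i = n then inverse (iu * qh) \<odot>\<^bsub>Cl n\<^esub> cl_class n (Vinv n)
      else cl_class n (V (i + 1)) \<otimes>\<^bsub>Cl n\<^esub> cl_class n (Vinv i))"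

definition spinor_hom :: "nat \<Rightarrow> osp_free set \<Rightarrow> cl_free set" where
  "spinor_hom n = induced_hom (Cl n) (pi_gen n)"

definition spinor_rep :: "nat \<Rightarrow> osp_free set \<Rightarrow> fock \<Rightarrow> fock" where
  "spinor_rep n u = fock_rep n (spinor_hom n u)"

end

theory Submission
  imports Defs
begin

text \<open>
  Any two of the letters \<open>\<psi>\<^sub>1, \<dots>, \<psi>\<^sub>n, \<psi>\<^sub>1\<^sup>\<dagger>, \<dots>, \<psi>\<^sub>n\<^sup>\<dagger>\<close> of the deformed Clifford algebra anticommute,
  except \<open>\<psi>\<^sub>i\<close> and \<open>\<psi>\<^sub>i\<^sup>\<dagger>\<close> at a common site \<open>i\<close>. Up to scalars, the images of \<open>e\<^sub>i\<close> and \<open>f\<^sub>i\<close> are monomials in one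
  or two of these letters, and a monomial vanishes as soon as a letter is repeated with only
  anticommuting letters in between (\<open>monomial_repeated_letter\<close>). This explains why the relations of the
  quantum supergroup hold in the Clifford algebra. Each image of \<open>e\<^sub>i\<close> squares to zero. Hence the second
  power of \<open>Ad\<close> of \<open>e\<^sub>i\<close>, applied to a weight vector \<open>x\<close>, is a multiple of \<open>e\<^sub>i x e\<^sub>i\<close>, and the third
  power is zero (\<open>twisted_ad_twice\<close>, \<open>twisted_ad_thrice\<close>). For \<open>i < n\<close> and a neighbour \<open>j\<close> of \<open>i\<close>, also
  \<open>e\<^sub>i e\<^sub>j e\<^sub>i\<close> vanishes, which gives the Serre relations; the same argument applies to the \<open>f\<^sub>i\<close>. The
  commutators of \<open>e\<^sub>i\<close> and \<open>f\<^sub>i\<close> come from the two deformed relations, which express \<open>v\<^sub>i\<close> and its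
  inverse by \<open>\<psi>\<^sub>i\<psi>\<^sub>i\<^sup>\<dagger>\<close> and \<open>\<psi>\<^sub>i\<^sup>\<dagger>\<psi>\<^sub>i\<close> (\<open>even_commutator\<close>, \<open>odd_commutator\<close>). The relations have
  to be verified in the abstract Clifford algebra and not only on Fock space, because Fock space is
  not a faithful module.

  For irreducibility, let \<open>W\<close> be a nonzero invariant subspace. It is invariant under \<open>\<psi>\<^sub>n\<close> and
  \<open>\<psi>\<^sub>n\<^sup>\<dagger>\<close>, since \<open>e\<^sub>n\<close> acts by a nonzero multiple of \<open>\<psi>\<^sub>n\<close> and \<open>f\<^sub>n\<close> by \<open>\<psi>\<^sub>n\<^sup>\<dagger>\<close>. On Fock space
  \<open>\<psi>\<^sub>i\<psi>\<^sub>i\<^sup>\<dagger> + \<psi>\<^sub>i\<^sup>\<dagger>\<psi>\<^sub>i = 1\<close>, and inserting this identity at the site \<open>i + 1\<close> writes \<open>\<psi>\<^sub>i\<close> in terms of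
  \<open>\<psi>\<^sub>i\<psi>\<^sub>i\<^sub>+\<^sub>1\<^sup>\<dagger>\<close>, which is the operator of \<open>e\<^sub>i\<close>, and \<open>\<psi>\<^sub>i\<^sub>+\<^sub>1\<close>; similarly for \<open>\<psi>\<^sub>i\<^sup>\<dagger>\<close>. By downward
  induction \<open>W\<close> is invariant under all \<open>\<psi>\<^sub>i\<close> and \<open>\<psi>\<^sub>i\<^sup>\<dagger>\<close> (\<open>flip_invariant\<close>), hence under the
  projections to a given occupation number at a given site. These projections isolate a single ket
  in \<open>W\<close> (\<open>ket_exists\<close>), and from one ket all others are reached by changing the occupation of one
  site at a time (\<open>all_kets\<close>).
\<close>

section \<open>Associative algebras and their presentations\<close>

text \<open>
  Unital algebras with a possibly noncommutative product. The scalars form a type, so they carry no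
  membership conditions.
\<close>

locale assoc_algebra = ring A for A :: "('k::field, 'a) module" (structure) +
  assumes smult_closed [simp, intro]: "x \<in> carrier A \<Longrightarrow> c \<odot> x \<in> carrier A"
    and smult_add: "x \<in> carrier A \<Longrightarrow> y \<in> carrier A \<Longrightarrow> c \<odot> (x \<oplus> y) = c \<odot> x \<oplus> c \<odot> y"
    and add_smult: "x \<in> carrier A \<Longrightarrow> (c + d) \<odot> x = c \<odot> x \<oplus> d \<odot> x"
    and smult_smult: "x \<in> carrier A \<Longrightarrow> c \<odot> (d \<odot> x) = (c * d) \<odot> x"
    and one_smult [simp]: "x \<in> carrier A \<Longrightarrow> 1 \<odot> x = x"
    and smult_mult_left: "x \<in> carrier A \<Longrightarrow> y \<in> carrier A \<Longrightarrow> (c \<odot> x) \<otimes> y = c \<odot> (x \<otimes> y)"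
    and smult_mult_right: "x \<in> carrier A \<Longrightarrow> y \<in> carrier A \<Longrightarrow> x \<otimes> (c \<odot> y) = c \<odot> (x \<otimes> y)"
begin

lemma zero_smult [simp]: "x \<in> carrier A \<Longrightarrow> 0 \<odot> x = \<zero>"
  using add_smult[of x 0 0] by simp

lemma smult_zero [simp]: "c \<odot> \<zero> = \<zero>"
  using smult_add[of \<zero> \<zero> c] by simp

lemma minus_smult: "x \<in> carrier A \<Longrightarrow> (- c) \<odot> x = \<ominus> (c \<odot> x)"
  using add_smult[of x "-c" c] by (simp add: minus_equality)

lemma smult_minus: "x \<in> carrier A \<Longrightarrow> c \<odot> (\<ominus> x) = \<ominus> (c \<odot> x)"
  using smult_add[of "\<ominus> x" x c] by (simp add: minus_equality l_neg)

lemma word_value_closed: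
  "\<phi> \<in> set gs \<rightarrow> carrier A \<Longrightarrow> foldr (\<lambda>g y. \<phi> g \<otimes> y) gs \<one> \<in> carrier A"
  by (induction gs) auto

lemma word_value_append:
  "\<phi> \<in> set gs \<rightarrow> carrier A \<Longrightarrow> \<phi> \<in> set hs \<rightarrow> carrier A \<Longrightarrow>
    foldr (\<lambda>g y. \<phi> g \<otimes> y) (gs @ hs) \<one>
      = foldr (\<lambda>g y. \<phi> g \<otimes> y) gs \<one> \<otimes> foldr (\<lambda>g y. \<phi> g \<otimes> y) hs \<one>"
  by (induction gs) (use word_value_closed[of \<phi>] in \<open>auto simp: m_assoc simp del: foldr_append\<close>)

end

lemma poly_mapping_single_induct [case_names zero add]:
  assumes "P 0" and "\<And>a b f. P f \<Longrightarrow> P (Poly_Mapping.single a b + f)"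
  shows "P (f :: 'a \<Rightarrow>\<^sub>0 'b::monoid_add)"
proof (induction f rule: update_induct)
  case const
  show ?case by fact
next
  case (update f a b)
  have "Poly_Mapping.update a b f = Poly_Mapping.single a b + f"
    using update(1) by (intro poly_mapping_eqI)
      (auto simp: lookup_update lookup_add lookup_single when_def in_keys_iff)
  with update assms(2) show ?case by simp
qed

text \<open>
  With a value for every letter, evaluation is defined on the whole type of finitely supported
  functions on words, so induction over such functions needs no side conditions on letters.
\<close>

locale total_valuation = assoc_algebra A for A :: "('k::field, 'a) module" (structure) +
  fixes \<phi> :: "'g \<Rightarrow> 'a"
  assumes phi_closed [simp]: "\<phi> g \<in> carrier A"
begin

abbreviation word_value :: "'g word \<Rightarrow> 'a" where
  "word_value w \<equiv> foldr (\<lambda>g y. \<phi> g \<otimes> y) (letters w) \<one>"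

lemma word_value_in [simp]: "word_value w \<in> carrier A"
  by (rule word_value_closed) auto

lemma word_value_plus: "word_value (u + w) = word_value u \<otimes> word_value w"
  unfolding plus_word_def word.sel by (rule word_value_append) auto

text \<open>
  Sums of two elements have to be compared over a common finite set of words; the words with
  coefficient zero contribute nothing.
\<close>

lemma free_eval_superset:
  assumes "finite S" "Poly_Mapping.keys p \<subseteq> S"
  shows "free_eval A \<phi> p = (\<Oplus>w\<in>S. Poly_Mapping.lookup p w \<odot> word_value w)"
  unfolding free_eval_def
  by (rule add.finprod_mono_neutral_cong_left) (use assms in \<open>auto simp: in_keys_iff\<close>)

lemma free_eval_closed [simp]: "free_eval A \<phi> p \<in> carrier A"
  unfolding free_eval_def by (rule finsum_closed) auto

lemma free_eval_add: "free_eval A \<phi> (p + r) = free_eval A \<phi> p \<oplus> free_eval A \<phi> r"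
proof -
  let ?S = "Poly_Mapping.keys p \<union> Poly_Mapping.keys r"
  have "free_eval A \<phi> (p + r) = (\<Oplus>w\<in>?S. Poly_Mapping.lookup (p + r) w \<odot> word_value w)"
    by (rule free_eval_superset) (use Poly_Mapping.keys_add[of p r] in auto)
  also have "\<dots> = (\<Oplus>w\<in>?S. Poly_Mapping.lookup p w \<odot> word_value w \<oplus> Poly_Mapping.lookup r w \<odot> word_value w)"
    by (simp add: lookup_add add_smult)
  also have "\<dots> = (\<Oplus>w\<in>?S. Poly_Mapping.lookup p w \<odot> word_value w) \<oplus> (\<Oplus>w\<in>?S. Poly_Mapping.lookup r w \<odot> word_value w)"
    by (rule finsum_addf) auto
  also have "\<dots> = free_eval A \<phi> p \<oplus> free_eval A \<phi> r"
    by (simp add: free_eval_superset[of ?S])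
  finally show ?thesis .
qed

lemma free_eval_zero [simp]: "free_eval A \<phi> 0 = \<zero>"
  by (simp add: free_eval_def)

lemma free_eval_single: "free_eval A \<phi> (Poly_Mapping.single w c) = c \<odot> word_value w"
  using free_eval_superset[of "{w}" "Poly_Mapping.single w c"] by simp

lemma free_eval_one [simp]: "free_eval A \<phi> 1 = \<one>"
proof -
  have "word_value 0 = \<one>"
    by (simp add: zero_word_def)
  then show ?thesis
    using free_eval_single[of 0 1] by simp
qed

lemma free_eval_gen: "free_eval A \<phi> (gen g) = \<phi> g"
  by (simp add: gen_def free_eval_single)

lemma free_eval_mult: "free_eval A \<phi> (p * r) = free_eval A \<phi> p \<otimes> free_eval A \<phi> r"
proof (induction p rule: poly_mapping_single_induct)
  case (add u b f)
  have "free_eval A \<phi> (Poly_Mapping.single u b * r) = (b \<odot> word_value u) \<otimes> free_eval A \<phi> r"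
  proof (induction r rule: poly_mapping_single_induct)
    case (add w c r)
    then show ?case
      by (simp add: distrib_left free_eval_add mult_single free_eval_single word_value_plus
          r_distr smult_mult_left smult_mult_right smult_smult mult.commute)
  qed simp
  with add show ?case
    by (simp add: distrib_right free_eval_add free_eval_single l_distr)
qed simp

lemma free_eval_smult: "free_eval A \<phi> (pm_scale c p) = c \<odot> free_eval A \<phi> p"
proof (induction p rule: poly_mapping_single_induct)
  case (add u b f)
  have *: "pm_scale c (Poly_Mapping.single u b) = Poly_Mapping.single u (c * b)"
    by (rule poly_mapping_eqI) (simp add: lookup_single when_def)
  from add show ?case
    by (simp add: pm.scale_right_distrib free_eval_add free_eval_single smult_add smult_smult *)
qed simp

end

context assoc_algebra
begin

lemma free_eval_cong:
  assumes "p \<in> carrier (free_algebra X)" "\<And>g. g \<in> X \<Longrightarrow> \<phi> g = \<psi> g" "\<psi> \<in> X \<rightarrow> carrier A"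
  shows "free_eval A \<phi> p = free_eval A \<psi> p"
  unfolding free_eval_def
proof (rule finsum_cong')
  fix w assume "w \<in> Poly_Mapping.keys p"
  then have w: "set (letters w) \<subseteq> X"
    using assms(1) by (auto simp: free_algebra_def)
  then have "foldr (\<lambda>g y. \<phi> g \<otimes> y) (letters w) \<one> = foldr (\<lambda>g y. \<psi> g \<otimes> y) (letters w) \<one>"
    using assms(2) by (intro foldr_cong) auto
  then show "Poly_Mapping.lookup p w \<odot> foldr (\<lambda>g y. \<phi> g \<otimes> y) (letters w) \<one>
      = Poly_Mapping.lookup p w \<odot> foldr (\<lambda>g y. \<psi> g \<otimes> y) (letters w) \<one>"
    by simp
next
  show "(\<lambda>w. Poly_Mapping.lookup p w \<odot> foldr (\<lambda>g y. \<psi> g \<otimes> y) (letters w) \<one>)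
      \<in> Poly_Mapping.keys p \<rightarrow> carrier A"
    using assms(1,3) by (auto simp: free_algebra_def intro!: word_value_closed)
qed simp

end

lemma free_algebra_simps [simp]:
  "mult (free_algebra X) = (*)" "one (free_algebra X) = 1" "zero (free_algebra X) = 0"
  "add (free_algebra X) = (+)" "smult (free_algebra X) = pm_scale"
  by (simp_all add: free_algebra_def)

lemma in_free_algebra:
  "p \<in> carrier (free_algebra X) \<longleftrightarrow> (\<forall>w\<in>Poly_Mapping.keys p. set (letters w) \<subseteq> X)"
  by (simp add: free_algebra_def)

lemma free_algebra_closed [simp, intro]:
  fixes p r :: "('g, 'k::field) free_alg"
  shows "0 \<in> carrier (free_algebra X)"
    and "1 \<in> carrier (free_algebra X)"
    and "g \<in> X \<Longrightarrow> (gen g :: ('g, 'k) free_alg) \<in> carrier (free_algebra X)"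
    and "p \<in> carrier (free_algebra X) \<Longrightarrow> pm_scale c p \<in> carrier (free_algebra X)"
    and "p \<in> carrier (free_algebra X) \<Longrightarrow> - p \<in> carrier (free_algebra X)"
    and "p \<in> carrier (free_algebra X) \<Longrightarrow> r \<in> carrier (free_algebra X) \<Longrightarrow>
      p + r \<in> carrier (free_algebra X)"
    and "p \<in> carrier (free_algebra X) \<Longrightarrow> r \<in> carrier (free_algebra X) \<Longrightarrow>
      p - r \<in> carrier (free_algebra X)"
    and "p \<in> carrier (free_algebra X) \<Longrightarrow> r \<in> carrier (free_algebra X) \<Longrightarrow>
      p * r \<in> carrier (free_algebra X)"
proof -
  show "0 \<in> carrier (free_algebra X)" "1 \<in> carrier (free_algebra X)"
    by (auto simp: in_free_algebra zero_word_def)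
  show "g \<in> X \<Longrightarrow> (gen g :: ('g, 'k) free_alg) \<in> carrier (free_algebra X)"
    by (simp add: in_free_algebra gen_def)
  show "p \<in> carrier (free_algebra X) \<Longrightarrow> pm_scale c p \<in> carrier (free_algebra X)"
    "p \<in> carrier (free_algebra X) \<Longrightarrow> - p \<in> carrier (free_algebra X)"
    by (auto simp: in_free_algebra in_keys_iff)
  assume *: "p \<in> carrier (free_algebra X)" "r \<in> carrier (free_algebra X)"
  show plus: "p + r \<in> carrier (free_algebra X)"
    using * Poly_Mapping.keys_add[of p r] unfolding in_free_algebra by blast
  show "p - r \<in> carrier (free_algebra X)"
    unfolding in_free_algebra
  proof
    fix w assume "w \<in> Poly_Mapping.keys (p - r)"
    then have "w \<in> Poly_Mapping.keys p \<or> w \<in> Poly_Mapping.keys r"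
      by (auto simp: in_keys_iff lookup_minus)
    with * show "set (letters w) \<subseteq> X"
      unfolding in_free_algebra by blast
  qed
  show "p * r \<in> carrier (free_algebra X)"
    unfolding in_free_algebra
  proof
    fix w assume "w \<in> Poly_Mapping.keys (p * r)"
    then obtain u v where "w = u + v" "u \<in> Poly_Mapping.keys p" "v \<in> Poly_Mapping.keys r"
      using keys_mult[of p r] by blast
    with * show "set (letters w) \<subseteq> X"
      unfolding in_free_algebra by (auto simp: plus_word_def)
  qed
qed

lemma
  fixes p r :: "('b::monoid_add) \<Rightarrow>\<^sub>0 ('k::field)"
  shows pm_scale_mult_left: "pm_scale c p * r = pm_scale c (p * r)"
    and pm_scale_mult_right: "p * pm_scale c r = pm_scale c (p * r)"
proof -
  have *: "pm_scale c p = Poly_Mapping.single 0 c * p" for p :: "'b \<Rightarrow>\<^sub>0 'k"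
    unfolding pm_scale_def by (rule mult_map_scale_conv_mult)
  show "pm_scale c p * r = pm_scale c (p * r)"
    by (simp add: * mult.assoc)
  have "p * Poly_Mapping.single 0 c = Poly_Mapping.single 0 c * p"
    by (induction p rule: poly_mapping_single_induct)
      (simp_all add: distrib_left distrib_right mult_single mult.commute)
  then show "p * pm_scale c r = pm_scale c (p * r)"
    by (simp add: * mult.assoc[symmetric])
qed

lemma assoc_algebra_free: "assoc_algebra (free_algebra X)"
proof -
  interpret ring "free_algebra X"
  proof (intro ringI abelian_groupI monoidI; simp?)
    show "\<exists>y\<in>carrier (free_algebra X). y + x = 0" if "x \<in> carrier (free_algebra X)" for x
      using that by (intro bexI[of _ "- x"]) auto
  qed (auto simp: algebra_simps)
  show ?thesis
    by unfold_locales
      (auto simp: pm.scale_right_distrib pm.scale_left_distrib pm_scale_mult_left pm_scale_mult_right)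
qed

context assoc_algebra
begin

text \<open>
  A valuation of the alphabet is extended by zero to all letters. This transports the laws
  proved for total valuations to elements of the free algebra on the alphabet.
\<close>

lemma free_eval_total:
  assumes "\<phi> \<in> X \<rightarrow> carrier A"
  obtains \<psi> where "total_valuation A \<psi>"
    and "\<And>p. p \<in> carrier (free_algebra X) \<Longrightarrow> free_eval A \<phi> p = free_eval A \<psi> p"
    and "\<And>g. g \<in> X \<Longrightarrow> \<phi> g = \<psi> g"
proof
  let ?\<psi> = "\<lambda>g. if g \<in> X then \<phi> g else \<zero>"
  show "total_valuation A ?\<psi>"
    by unfold_locales (use assms in auto)
  show "free_eval A \<phi> p = free_eval A ?\<psi> p" if "p \<in> carrier (free_algebra X)" for p
    by (rule free_eval_cong[OF that]) (use assms in auto)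
qed auto

lemma free_eval_partial:
  assumes \<phi>: "\<phi> \<in> X \<rightarrow> carrier A"
  shows free_eval_in: "p \<in> carrier (free_algebra X) \<Longrightarrow> free_eval A \<phi> p \<in> carrier A"
    and free_eval_plus: "p \<in> carrier (free_algebra X) \<Longrightarrow> r \<in> carrier (free_algebra X) \<Longrightarrow>
      free_eval A \<phi> (p + r) = free_eval A \<phi> p \<oplus> free_eval A \<phi> r"
    and free_eval_times: "p \<in> carrier (free_algebra X) \<Longrightarrow> r \<in> carrier (free_algebra X) \<Longrightarrow>
      free_eval A \<phi> (p * r) = free_eval A \<phi> p \<otimes> free_eval A \<phi> r"
    and free_eval_diff: "p \<in> carrier (free_algebra X) \<Longrightarrow> r \<in> carrier (free_algebra X) \<Longrightarrow>
      free_eval A \<phi> (p - r) = free_eval A \<phi> p \<ominus> free_eval A \<phi> r"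
    and free_eval_scale: "p \<in> carrier (free_algebra X) \<Longrightarrow>
      free_eval A \<phi> (pm_scale c p) = c \<odot> free_eval A \<phi> p"
    and free_eval_1: "free_eval A \<phi> 1 = \<one>"
    and free_eval_0: "free_eval A \<phi> 0 = \<zero>"
    and free_eval_letter: "g \<in> X \<Longrightarrow> free_eval A \<phi> (gen g) = \<phi> g"
proof -
  from free_eval_total[OF \<phi>] obtain \<psi> where \<psi>: "total_valuation A \<psi>"
    and *: "\<And>p. p \<in> carrier (free_algebra X) \<Longrightarrow> free_eval A \<phi> p = free_eval A \<psi> p"
    and eq: "\<And>g. g \<in> X \<Longrightarrow> \<phi> g = \<psi> g" by blast
  interpret total_valuation A \<psi> by (rule \<psi>)
  show "p \<in> carrier (free_algebra X) \<Longrightarrow> free_eval A \<phi> p \<in> carrier A"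
    and "p \<in> carrier (free_algebra X) \<Longrightarrow> free_eval A \<phi> (pm_scale c p) = c \<odot> free_eval A \<phi> p"
    and "free_eval A \<phi> 1 = \<one>"
    and "free_eval A \<phi> 0 = \<zero>"
    by (simp_all add: * free_eval_smult)
  show "g \<in> X \<Longrightarrow> free_eval A \<phi> (gen g) = \<phi> g"
    using free_eval_gen[of g] by (simp add: * eq)
  assume p: "p \<in> carrier (free_algebra X)" and r: "r \<in> carrier (free_algebra X)"
  then show "free_eval A \<phi> (p + r) = free_eval A \<phi> p \<oplus> free_eval A \<phi> r"
    and "free_eval A \<phi> (p * r) = free_eval A \<phi> p \<otimes> free_eval A \<phi> r"
    by (simp_all add: * free_eval_add free_eval_mult)
  have "free_eval A \<psi> p = free_eval A \<psi> (p - r) \<oplus> free_eval A \<psi> r"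
    by (simp flip: free_eval_add)
  with p r show "free_eval A \<phi> (p - r) = free_eval A \<phi> p \<ominus> free_eval A \<phi> r"
    by (simp add: * minus_eq a_assoc r_neg)
qed

lemma free_eval_algebra_hom:
  assumes "\<phi> \<in> X \<rightarrow> carrier A"
  shows "free_eval A \<phi> \<in> algebra_hom (free_algebra X) A"
  unfolding algebra_hom_def using assms
  by (auto intro!: ring_hom_memI simp: free_eval_partial)

end

locale presentation =
  fixes X :: "'g set" and R :: "('g, 'k::field) free_alg \<Rightarrow> ('g, 'k) free_alg \<Rightarrow> bool"
  assumes relations_closed: "R a b \<Longrightarrow> a \<in> carrier (free_algebra X) \<and> b \<in> carrier (free_algebra X)"
begin

sublocale free: assoc_algebra "free_algebra X :: ('k, ('g, 'k) free_alg) module"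
  by (rule assoc_algebra_free)

abbreviation coset :: "('g, 'k) free_alg \<Rightarrow> ('g, 'k) free_alg set" where
  "coset p \<equiv> rel_ideal X R +>\<^bsub>free_algebra X\<^esub> p"

lemma ideal_rel_ideal:
  "ideal (rel_ideal X R) (free_algebra X :: ('k, ('g, 'k) free_alg) module)"
  unfolding rel_ideal_def
  by (rule free.genideal_ideal) (use relations_closed in auto)

lemma carrier_presented: "carrier (presented_algebra X R) = coset ` carrier (free_algebra X)"
  by (auto simp: presented_algebra_def FactRing_def A_RCOSETS_def' Let_def)

lemma coset_closed [simp, intro]:
  "p \<in> carrier (free_algebra X) \<Longrightarrow> coset p \<in> carrier (presented_algebra X R)"
  by (simp add: carrier_presented)

lemma presented_ops:
  "one (presented_algebra X R) = coset 1"
  "zero (presented_algebra X R) = coset 0"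
  "p \<in> carrier (free_algebra X) \<Longrightarrow> r \<in> carrier (free_algebra X) \<Longrightarrow>
    coset p \<oplus>\<^bsub>presented_algebra X R\<^esub> coset r = coset (p + r)"
  "p \<in> carrier (free_algebra X) \<Longrightarrow> r \<in> carrier (free_algebra X) \<Longrightarrow>
    coset p \<otimes>\<^bsub>presented_algebra X R\<^esub> coset r = coset (p * r)"
proof -
  interpret relations: ideal "rel_ideal X R" "free_algebra X :: ('k, ('g, 'k) free_alg) module"
    by (rule ideal_rel_ideal)
  show "zero (presented_algebra X R) = coset 0"
    using free.a_coset_add_zero[OF relations.a_subset]
    by (simp add: presented_algebra_def FactRing_def Let_def)
  show "one (presented_algebra X R) = coset 1"
    by (simp add: presented_algebra_def FactRing_def Let_def)
  assume "p \<in> carrier (free_algebra X)" "r \<in> carrier (free_algebra X)"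
  then show "coset p \<oplus>\<^bsub>presented_algebra X R\<^esub> coset r = coset (p + r)"
    and "coset p \<otimes>\<^bsub>presented_algebra X R\<^esub> coset r = coset (p * r)"
    by (simp_all add: presented_algebra_def FactRing_def Let_def relations.rcoset_mult_add
        relations.a_rcos_sum)
qed

lemma coset_eq_iff:
  assumes "p \<in> carrier (free_algebra X)" "r \<in> carrier (free_algebra X)"
  shows "coset p = coset r \<longleftrightarrow> p - r \<in> rel_ideal X R"
proof -
  interpret relations: ideal "rel_ideal X R" "free_algebra X :: ('k, ('g, 'k) free_alg) module"
    by (rule ideal_rel_ideal)
  have minus: "a \<ominus>\<^bsub>free_algebra X\<^esub> b = a - b"
    if "a \<in> carrier (free_algebra X)" "b \<in> carrier (free_algebra X)" for a b :: "('g, 'k) free_alg"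
    using free.minus_equality[of "- b" b] that
    by (simp add: a_minus_def)
  show ?thesis
    using free.quotient_eq_iff_same_a_r_cos[OF relations.ideal_axioms assms] assms by (simp add: minus)
qed

text \<open>
  The scalar multiple of a coset is well defined because the ideal is closed under left
  multiplication by the scalar multiples of \<open>1\<close>.
\<close>

lemma presented_smult:
  assumes p: "p \<in> carrier (free_algebra X)"
  shows "c \<odot>\<^bsub>presented_algebra X R\<^esub> coset p = coset (pm_scale c p)"
proof -
  interpret relations: ideal "rel_ideal X R" "free_algebra X :: ('k, ('g, 'k) free_alg) module"
    by (rule ideal_rel_ideal)
  have "coset (pm_scale c y) = coset (pm_scale c p)" if "y \<in> coset p" for y
  proof -
    have y: "y \<in> carrier (free_algebra X)"
      using that p relations.a_subset free.a_r_coset_subset_G by blast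
    have "coset y = coset p"
      using relations.a_repr_independence'[OF that p] by simp
    then have "y - p \<in> rel_ideal X R"
      using y p coset_eq_iff by blast
    then have "pm_scale c 1 * (y - p) \<in> rel_ideal X R"
      using relations.I_l_closed[of "y - p" "pm_scale c 1"] by simp
    then have "pm_scale c y - pm_scale c p \<in> rel_ideal X R"
      by (simp add: pm_scale_mult_left pm.scale_right_diff_distrib)
    then show ?thesis
      using y p coset_eq_iff by auto
  qed
  then have "(\<Union>y\<in>coset p. coset (pm_scale c y)) = (\<Union>y\<in>coset p. coset (pm_scale c p))"
    by (intro SUP_cong refl)
  also have "\<dots> = coset (pm_scale c p)"
    by (rule UN_constant_eq[OF relations.a_rcos_self[OF p]]) (rule ballI, rule refl)
  finally show ?thesis
    by (simp add: presented_algebra_def Let_def)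
qed

text \<open>
  Read from left to right, these equations turn a relation between cosets of the free algebra
  into an equation between the classes of the generators.
\<close>

lemma coset_ops:
  "coset 1 = one (presented_algebra X R)"
  "coset 0 = zero (presented_algebra X R)"
  "p \<in> carrier (free_algebra X) \<Longrightarrow> r \<in> carrier (free_algebra X) \<Longrightarrow>
    coset (p + r) = coset p \<oplus>\<^bsub>presented_algebra X R\<^esub> coset r"
  "p \<in> carrier (free_algebra X) \<Longrightarrow> r \<in> carrier (free_algebra X) \<Longrightarrow>
    coset (p * r) = coset p \<otimes>\<^bsub>presented_algebra X R\<^esub> coset r"
  "p \<in> carrier (free_algebra X) \<Longrightarrow> coset (pm_scale k p) = k \<odot>\<^bsub>presented_algebra X R\<^esub> coset p"
  "coset (gen g) = gen_class X R g"
  by (simp_all add: presented_ops presented_smult gen_class_def)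

lemma assoc_algebra_presented: "assoc_algebra (presented_algebra X R)"
proof -
  interpret Q: ring "presented_algebra X R"
  proof (intro ringI abelian_groupI monoidI)
    fix x assume "x \<in> carrier (presented_algebra X R)"
    then obtain p where p: "p \<in> carrier (free_algebra X)" "x = coset p"
      by (auto simp: carrier_presented)
    then show "\<exists>y\<in>carrier (presented_algebra X R). y \<oplus>\<^bsub>presented_algebra X R\<^esub> x = \<zero>\<^bsub>presented_algebra X R\<^esub>"
      by (intro bexI[of _ "coset (- p)"]) (simp_all add: presented_ops coset_closed)
  qed (auto simp: carrier_presented presented_ops algebra_simps)
  show ?thesis
    by unfold_locales
      (auto simp: carrier_presented presented_ops presented_smult pm.scale_right_distrib
         pm.scale_left_distrib pm_scale_mult_left pm_scale_mult_right)
qed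

lemma gen_class_closed: "g \<in> X \<Longrightarrow> gen_class X R g \<in> carrier (presented_algebra X R)"
  by (simp add: gen_class_def)

lemma relation_holds: "R a b \<Longrightarrow> coset a = coset b"
  unfolding coset_eq_iff[OF conjunct1[OF relations_closed] conjunct2[OF relations_closed]]
  unfolding rel_ideal_def
  by (rule free.genideal_self[THEN subsetD]) (use relations_closed in auto)

end

text \<open>
  The universal property of a presentation: a valuation of the generators under which both sides
  of every relation agree factors through the presented algebra.
\<close>

locale respectful_valuation = presentation X R + B: assoc_algebra B
  for X :: "'g set" and R :: "('g, 'k::field) free_alg \<Rightarrow> ('g, 'k) free_alg \<Rightarrow> bool"
    and B :: "('k, 'b) module" (structure) +
  fixes \<phi> :: "'g \<Rightarrow> 'b"
  assumes valued: "\<phi> \<in> X \<rightarrow> carrier B"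
    and respects: "R a b \<Longrightarrow> free_eval B \<phi> a = free_eval B \<phi> b"
begin

text \<open>
  The kernel of the evaluation is an ideal containing all differences of related elements, hence
  it contains the ideal of relations, and evaluation is constant on cosets.
\<close>

lemma induced_hom_coset:
  assumes p: "p \<in> carrier (free_algebra X)"
  shows "induced_hom B \<phi> (coset p) = free_eval B \<phi> p"
proof -
  interpret relations: ideal "rel_ideal X R" "free_algebra X :: ('k, ('g, 'k) free_alg) module"
    by (rule ideal_rel_ideal)
  note ev = B.free_eval_partial[OF valued]
  have hom: "ring_hom_ring (free_algebra X) B (free_eval B \<phi>)"
  proof (rule ring_hom_ringI2)
    show "ring (free_algebra X :: ('k, ('g, 'k) free_alg) module)" "ring B"
      by unfold_locales
    show "free_eval B \<phi> \<in> ring_hom (free_algebra X) B"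
      using B.free_eval_algebra_hom[OF valued] by (simp add: algebra_hom_def)
  qed
  have "rel_ideal X R \<subseteq> a_kernel (free_algebra X) B (free_eval B \<phi>)"
    unfolding rel_ideal_def
  proof (rule free.genideal_minimal[OF ring_hom_ring.kernel_is_ideal[OF hom]], safe)
    fix a b assume ab: "R a b"
    have in_free: "a \<in> carrier (free_algebra X)" "b \<in> carrier (free_algebra X)"
      using relations_closed[OF ab] by auto
    have "free_eval B \<phi> (a - b) = free_eval B \<phi> b \<ominus> free_eval B \<phi> b"
      using respects[OF ab] by (metis B.free_eval_diff valued in_free)
    also have "\<dots> = \<zero>"
      unfolding B.minus_eq by (rule B.r_neg[OF B.free_eval_in[OF valued in_free(2)]])
    finally have "free_eval B \<phi> (a - b) = \<zero>" .
    then show "a - b \<in> a_kernel (free_algebra X) B (free_eval B \<phi>)"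
      using in_free by (simp add: a_kernel_def')
  qed
  then have kernel: "h \<in> carrier (free_algebra X) \<and> free_eval B \<phi> h = \<zero>" if "h \<in> rel_ideal X R" for h
    using that unfolding a_kernel_def' by blast
  have "free_eval B \<phi> y = free_eval B \<phi> p" if y: "y \<in> coset p" for y
  proof -
    from y obtain h where "h \<in> rel_ideal X R" and "y = h + p"
      unfolding a_r_coset_def' by auto
    with kernel[of h] p show ?thesis
      by (simp add: ev)
  qed
  then have "free_eval B \<phi> ` coset p = (\<lambda>y. free_eval B \<phi> p) ` coset p"
    by (intro image_cong refl)
  also have "\<dots> = {free_eval B \<phi> p}"
    using relations.a_rcos_self[OF p] by (rule image_constant)
  finally show ?thesis
    by (simp add: induced_hom_def)
qed

lemma induced_hom_gen_class: "g \<in> X \<Longrightarrow> induced_hom B \<phi> (gen_class X R g) = \<phi> g"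
  by (simp add: gen_class_def induced_hom_coset B.free_eval_letter[OF valued])

lemma induced_hom_algebra_hom: "induced_hom B \<phi> \<in> algebra_hom (presented_algebra X R) B"
  unfolding algebra_hom_def
  by (auto intro!: ring_hom_memI
      simp: carrier_presented presented_ops presented_smult induced_hom_coset
        B.free_eval_partial[OF valued])

end

lemma algebra_hom_comp:
  assumes "g \<in> algebra_hom A B" "h \<in> algebra_hom B C"
  shows "(\<lambda>x. h (g x)) \<in> algebra_hom A C"
  using assms by (auto simp: algebra_hom_def ring_hom_def Pi_iff)

section \<open>Operators on Fock space\<close>

lemma End_algebra_simps [simp]:
  "mult (End_algebra M) = compose M" "one (End_algebra M) = (\<lambda>v\<in>M. v)"
  "zero (End_algebra M) = (\<lambda>v\<in>M. 0)" "add (End_algebra M) = (\<lambda>S T. \<lambda>v\<in>M. S v + T v)"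
  "smult (End_algebra M) = (\<lambda>c T. \<lambda>v\<in>M. pm_scale c (T v))"
  by (simp_all add: End_algebra_def)

lemma in_End_algebra:
  "T \<in> carrier (End_algebra M) \<longleftrightarrow> T \<in> M \<rightarrow>\<^sub>E M \<and> (\<forall>v\<in>M. \<forall>w\<in>M. T (v + w) = T v + T w) \<and>
    (\<forall>c. \<forall>v\<in>M. T (pm_scale c v) = pm_scale c (T v))"
  by (simp add: End_algebra_def)

lemma assoc_algebra_End:
  fixes M :: "('b \<Rightarrow>\<^sub>0 'k::field) set"
  assumes M: "pm.subspace M"
  shows "assoc_algebra (End_algebra M)"
proof -
  note closed = pm.subspace_0[OF M] pm.subspace_add[OF M] pm.subspace_scale[OF M]
  have app: "T v \<in> M" if "T \<in> carrier (End_algebra M)" "v \<in> M" for T v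
    using that by (auto simp: in_End_algebra)
  have ext: "S = T" if "S \<in> carrier (End_algebra M)" "T \<in> carrier (End_algebra M)"
    "\<And>v. v \<in> M \<Longrightarrow> S v = T v" for S T
    using that by (auto simp: in_End_algebra intro: PiE_ext)
  have add: "(\<lambda>v\<in>M. S v + T v) \<in> carrier (End_algebra M)"
    if "S \<in> carrier (End_algebra M)" "T \<in> carrier (End_algebra M)" for S T
    using that app[OF that(1)] app[OF that(2)]
    by (auto simp: in_End_algebra closed algebra_simps pm.scale_right_distrib)
  have scale: "(\<lambda>v\<in>M. pm_scale c (T v)) \<in> carrier (End_algebra M)"
    if "T \<in> carrier (End_algebra M)" for c T
    using that app[OF that]
    by (auto simp: in_End_algebra closed pm.scale_right_distrib pm.scale_left_commute)
  have comp: "compose M S T \<in> carrier (End_algebra M)"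
    if "S \<in> carrier (End_algebra M)" "T \<in> carrier (End_algebra M)" for S T
    using that app[OF that(2)] by (auto simp: in_End_algebra closed compose_def)
  have zero: "(\<lambda>v\<in>M. 0) \<in> carrier (End_algebra M)" and one: "(\<lambda>v\<in>M. v) \<in> carrier (End_algebra M)"
    by (auto simp: in_End_algebra closed)
  have lin: "T (v + w) = T v + T w" "T (pm_scale c v) = pm_scale c (T v)"
    if "T \<in> carrier (End_algebra M)" "v \<in> M" "w \<in> M" for T v w c
    using that by (auto simp: in_End_algebra)
  interpret ring "End_algebra M"
  proof (intro ringI abelian_groupI monoidI; simp?)
    fix T assume T: "T \<in> carrier (End_algebra M)"
    show "\<exists>S\<in>carrier (End_algebra M). (\<lambda>v\<in>M. S v + T v) = (\<lambda>v\<in>M. 0)"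
      by (rule bexI[OF _ scale[OF T, of "- 1"]]) (auto simp: fun_eq_iff)
  next
    fix S T U assume *: "S \<in> carrier (End_algebra M)" "T \<in> carrier (End_algebra M)"
      "U \<in> carrier (End_algebra M)"
    show "compose M (compose M S T) U = compose M S (compose M T U)"
      using app[OF *(3)] by (auto simp: fun_eq_iff compose_def)
    show "compose M (\<lambda>v\<in>M. S v + T v) U = (\<lambda>v\<in>M. compose M S U v + compose M T U v)"
      using app[OF *(3)] by (auto simp: fun_eq_iff compose_def)
    show "compose M U (\<lambda>v\<in>M. S v + T v) = (\<lambda>v\<in>M. compose M U S v + compose M U T v)"
      using app[OF *(1)] app[OF *(2)] lin[OF *(3)] by (auto simp: fun_eq_iff compose_def)
    show "(\<lambda>v\<in>M. (if v \<in> M then S v + T v else undefined) + U v)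
        = (\<lambda>v\<in>M. S v + (if v \<in> M then T v + U v else undefined))"
      by (auto simp: fun_eq_iff algebra_simps)
  next
    fix S T assume *: "S \<in> carrier (End_algebra M)" "T \<in> carrier (End_algebra M)"
    show "(\<lambda>v\<in>M. S v + T v) = (\<lambda>v\<in>M. T v + S v)"
      by (auto simp: add.commute)
  next
    fix S assume *: "S \<in> carrier (End_algebra M)"
    show "compose M (\<lambda>v\<in>M. v) S = S" "compose M S (\<lambda>v\<in>M. v) = S"
      "(\<lambda>v\<in>M. (if v \<in> M then 0 else undefined) + S v) = S"
      using * app[OF *] by (auto simp: fun_eq_iff compose_def in_End_algebra)
  qed (auto intro!: add comp zero one simp: algebra_simps cong: restrict_cong)
  show ?thesis
  proof unfold_locales
    fix S T c assume *: "S \<in> carrier (End_algebra M)" "T \<in> carrier (End_algebra M)"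
    show "S \<otimes>\<^bsub>End_algebra M\<^esub> (c \<odot>\<^bsub>End_algebra M\<^esub> T) = c \<odot>\<^bsub>End_algebra M\<^esub> (S \<otimes>\<^bsub>End_algebra M\<^esub> T)"
      using app[OF *(2)] lin[OF *(1)] by (auto simp: fun_eq_iff compose_def)
    show "(c \<odot>\<^bsub>End_algebra M\<^esub> S) \<otimes>\<^bsub>End_algebra M\<^esub> T = c \<odot>\<^bsub>End_algebra M\<^esub> (S \<otimes>\<^bsub>End_algebra M\<^esub> T)"
      using app[OF *(2)] by (auto simp: fun_eq_iff compose_def)
  next
    fix S assume *: "S \<in> carrier (End_algebra M)"
    show "1 \<odot>\<^bsub>End_algebra M\<^esub> S = S"
      using * by (auto simp: fun_eq_iff in_End_algebra)
  qed (auto intro: scale simp: fun_eq_iff pm.scale_right_distrib pm.scale_left_distrib)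
qed

lemma in_fock_space:
  "v \<in> fock_space n \<longleftrightarrow> (\<forall>r. r \<notin> occupation n \<longrightarrow> Poly_Mapping.lookup v r = 0)"
  by (auto simp: fock_space_def in_keys_iff)

lemma subspace_fock_space: "pm.subspace (fock_space n)"
  by (rule pm.subspaceI) (auto simp: in_fock_space lookup_add)

interpretation fock: assoc_algebra "End_algebra (fock_space n)" for n
  by (rule assoc_algebra_End[OF subspace_fock_space])

lemma finite_occupation [simp]: "finite (occupation n)"
  by (auto simp: occupation_def intro: finite_PiE)

lemma occupation_update [simp]:
  "r \<in> occupation n \<Longrightarrow> i \<in> {1..n} \<Longrightarrow> c = 0 \<or> c = 1 \<Longrightarrow> r(i := c) \<in> occupation n"
  by (auto simp: occupation_def PiE_iff extensional_def)

lemma occupation_cases: "r \<in> occupation n \<Longrightarrow> i \<in> {1..n} \<Longrightarrow> r i = 0 \<or> r i = 1"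
  by (auto simp: occupation_def PiE_iff)

lemma ket_in_fock [simp]: "r \<in> occupation n \<Longrightarrow> ket r \<in> fock_space n"
  by (simp add: fock_space_def ket_def)

lemmas fock_closed [simp] =
  pm.subspace_0[OF subspace_fock_space] pm.subspace_add[OF subspace_fock_space]
  pm.subspace_scale[OF subspace_fock_space]

lemma fock_expansion:
  assumes "v \<in> fock_space n"
  shows "v = (\<Sum>r\<in>occupation n. pm_scale (Poly_Mapping.lookup v r) (ket r))"
proof (rule poly_mapping_eqI)
  fix s
  have "Poly_Mapping.lookup v s = (\<Sum>r\<in>occupation n. if r = s then Poly_Mapping.lookup v r else 0)"
    using assms by (auto simp: fock_space_def in_keys_iff sum.delta)
  then show "Poly_Mapping.lookup v s =
      Poly_Mapping.lookup (\<Sum>r\<in>occupation n. pm_scale (Poly_Mapping.lookup v r) (ket r)) s"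
    by (simp add: lookup_sum ket_def lookup_single when_def if_distrib cong: if_cong)
qed

lemma End_fock_app:
  assumes "T \<in> carrier (End_algebra (fock_space n))"
  shows "v \<in> fock_space n \<Longrightarrow> T v \<in> fock_space n"
    and "v \<in> fock_space n \<Longrightarrow> w \<in> fock_space n \<Longrightarrow> T (v + w) = T v + T w"
    and "v \<in> fock_space n \<Longrightarrow> T (pm_scale c v) = pm_scale c (T v)"
    and "T 0 = 0"
proof -
  show "v \<in> fock_space n \<Longrightarrow> T (pm_scale c v) = pm_scale c (T v)" for v c
    using assms by (auto simp: in_End_algebra)
  from this[of 0 0] show "T 0 = 0" by simp
qed (use assms in \<open>auto simp: in_End_algebra\<close>)

lemma End_fock_sum:
  assumes T: "T \<in> carrier (End_algebra (fock_space n))" and "\<And>r. r \<in> S \<Longrightarrow> f r \<in> fock_space n"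
  shows "T (\<Sum>r\<in>S. f r) = (\<Sum>r\<in>S. T (f r))"
  using assms(2)
proof (induction S rule: infinite_finite_induct)
  case (insert x S)
  then have "(\<Sum>r\<in>S. f r) \<in> fock_space n"
    by (intro pm.subspace_sum[OF subspace_fock_space]) auto
  with insert T show ?case
    by (simp add: End_fock_app[OF T])
qed (simp_all add: End_fock_app[OF T])

text \<open>
  Linearity extends an identity of operators from the kets to Fock space; every relation below is
  checked on kets only.
\<close>

lemma End_fock_eqI:
  assumes S: "S \<in> carrier (End_algebra (fock_space n))"
    and T: "T \<in> carrier (End_algebra (fock_space n))"
    and kets: "\<And>r. r \<in> occupation n \<Longrightarrow> S (ket r) = T (ket r)"
  shows "S = T"
proof -
  have "S v = T v" if v: "v \<in> fock_space n" for v
  proof -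
    have "S v = (\<Sum>r\<in>occupation n. S (pm_scale (Poly_Mapping.lookup v r) (ket r)))"
      by (subst fock_expansion[OF v]) (rule End_fock_sum[OF S], simp)
    also have "\<dots> = (\<Sum>r\<in>occupation n. T (pm_scale (Poly_Mapping.lookup v r) (ket r)))"
      by (intro sum.cong refl) (simp add: End_fock_app[OF S] End_fock_app[OF T] kets)
    also have "\<dots> = T v"
      by (subst (2) fock_expansion[OF v]) (rule End_fock_sum[OF T, symmetric], simp)
    finally show ?thesis .
  qed
  with S T show ?thesis
    by (auto simp: in_End_algebra intro: PiE_ext)
qed

lemma linear_extension_alt:
  assumes "v \<in> fock_space n"
  shows "linear_extension n f v = (\<Sum>r\<in>occupation n. pm_scale (Poly_Mapping.lookup v r) (f r))"
  using assms unfolding linear_extension_def restrict_apply' [OF assms]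
  by (intro sum.mono_neutral_left) (auto simp: fock_space_def in_keys_iff)

lemma linear_extension_closed:
  assumes "\<And>r. r \<in> occupation n \<Longrightarrow> f r \<in> fock_space n"
  shows "linear_extension n f \<in> carrier (End_algebra (fock_space n))"
  unfolding in_End_algebra
proof (intro conjI ballI allI PiE_I)
  fix v assume v: "v \<in> fock_space n"
  show "linear_extension n f v \<in> fock_space n"
    unfolding linear_extension_alt[OF v]
    by (rule pm.subspace_sum[OF subspace_fock_space]) (simp add: assms)
  show "linear_extension n f (pm_scale c v) = pm_scale c (linear_extension n f v)" for c
    using v by (simp add: linear_extension_alt pm.scale_sum_right)
  show "linear_extension n f (v + w) = linear_extension n f v + linear_extension n f w"
    if "w \<in> fock_space n" for w
    using v that by (simp add: linear_extension_alt lookup_add pm.scale_left_distrib sum.distrib)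
qed (simp add: linear_extension_def)

lemma linear_extension_ket: "r \<in> occupation n \<Longrightarrow> linear_extension n f (ket r) = f r"
  by (simp add: linear_extension_def) (simp add: ket_def)

text \<open>
  The sign \<open>(-1)\<close> to the power \<open>r\<^sub>1 + \<dots> + r\<^bsub>i-1\<^esub>\<close> in the action of \<open>\<psi>\<^sub>i\<close> and
  \<open>\<psi>\<^sub>i\<^sup>\<dagger>\<close>.
\<close>

definition site_sign :: "nat \<Rightarrow> (nat \<Rightarrow> nat) \<Rightarrow> qfield" where
  "site_sign i r = (- 1) ^ (\<Sum>j\<in>{1..<i}. r j)"

text \<open>
  The operators of \<open>\<psi>\<^sub>i\<close> and \<open>\<psi>\<^sub>i\<^sup>\<dagger>\<close> exchange the two occupation numbers of
  the site \<open>i\<close>, with the same sign. The index \<open>b\<close> is the occupation number before the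
  exchange, so \<open>b = 1\<close> gives \<open>\<psi>\<^sub>i\<close> and \<open>b = 0\<close> gives \<open>\<psi>\<^sub>i\<^sup>\<dagger>\<close>; one sign computation then
  serves all anticommutation relations.
\<close>

definition flip :: "nat \<Rightarrow> nat \<Rightarrow> nat \<Rightarrow> fock \<Rightarrow> fock" where
  "flip n b i = linear_extension n
     (\<lambda>r. if r i = b then pm_scale (site_sign i r) (ket (r(i := 1 - b))) else 0)"

lemma cl_action_flip: "cl_action n (Psi i) = flip n 1 i" "cl_action n (Psid i) = flip n 0 i"
  by (simp_all add: flip_def site_sign_def cong: if_cong)

lemma site_sign_update_later [simp]: "i \<le> j \<Longrightarrow> site_sign i (r(j := c)) = site_sign i r"
  unfolding site_sign_def by (intro arg_cong[where f = "(^) (- 1)"] sum.cong) auto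

lemma site_sign_flip_earlier:
  assumes "1 \<le> j" "j < i" "r j + c = 1"
  shows "site_sign i (r(j := c)) = - site_sign i r"
proof -
  have j: "j \<in> {1..<i}" using assms by simp
  have "(\<Sum>k\<in>{1..<i}. (r(j := c)) k) = c + (\<Sum>k\<in>{1..<i} - {j}. r k)"
    by (subst sum.remove[OF _ j]) (auto intro!: sum.cong)
  moreover have "(\<Sum>k\<in>{1..<i}. r k) = r j + (\<Sum>k\<in>{1..<i} - {j}. r k)"
    by (subst sum.remove[OF _ j]) auto
  moreover have "r j = 0 \<and> c = 1 \<or> r j = 1 \<and> c = 0"
    using assms by auto
  ultimately show ?thesis
    unfolding site_sign_def by (auto simp: power_add)
qed

lemma site_sign_square [simp]: "site_sign i r * site_sign i r = 1"
  by (simp add: site_sign_def flip: power_mult_distrib)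

lemma site_sign_nonzero [simp]: "site_sign i r \<noteq> 0"
  by (simp add: site_sign_def)

lemma flip_closed [simp]:
  "i \<in> {1..n} \<Longrightarrow> b = 0 \<or> b = 1 \<Longrightarrow> flip n b i \<in> carrier (End_algebra (fock_space n))"
  unfolding flip_def by (rule linear_extension_closed) auto

lemma flip_ket:
  "r \<in> occupation n \<Longrightarrow>
    flip n b i (ket r) = (if r i = b then pm_scale (site_sign i r) (ket (r(i := 1 - b))) else 0)"
  unfolding flip_def by (rule linear_extension_ket)

lemma flip_linear:
  assumes "i \<in> {1..n}" "b = 0 \<or> b = 1"
  shows "v \<in> fock_space n \<Longrightarrow> flip n b i (pm_scale c v) = pm_scale c (flip n b i v)"
    and "flip n b i 0 = 0"
    and "v \<in> fock_space n \<Longrightarrow> flip n b i v \<in> fock_space n"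
  using End_fock_app[OF flip_closed[OF assms]] by auto

text \<open>
  For \<open>i < j\<close>, the sign of the site \<open>i\<close> ignores the occupation of \<open>j\<close>, whereas the sign of \<open>j\<close>
  counts the site \<open>i\<close> and is reversed when \<open>i\<close> is flipped first. So the two orders differ by
  exactly one sign.
\<close>

lemma flip_anticommute:
  assumes i: "i \<in> {1..n}" and j: "j \<in> {1..n}" and "i \<noteq> j"
    and b: "b = 0 \<or> b = 1" and c: "c = 0 \<or> c = 1" and r: "r \<in> occupation n"
  shows "flip n b i (flip n c j (ket r)) + flip n c j (flip n b i (ket r)) = 0"
proof -
  have *: "flip n b i (flip n c j (ket r)) + flip n c j (flip n b i (ket r)) = 0"
    if "i < j" "i \<in> {1..n}" "j \<in> {1..n}" "b = 0 \<or> b = 1" "c = 0 \<or> c = 1" for i j b c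
  proof -
    have "r(j := 1 - c) \<in> occupation n" "r(i := 1 - b) \<in> occupation n"
      using that r by auto
    then show ?thesis
      using that r
      by (elim disjE)
        (simp_all add: flip_ket flip_linear site_sign_flip_earlier fun_upd_twist mult.commute)
  qed
  show ?thesis
  proof (cases "i < j")
    case True
    then show ?thesis using * assms by blast
  next
    case False
    then show ?thesis using *[of j i c b] assms by (simp add: add.commute)
  qed
qed

text \<open>
  Flipping back uses the same sign once more, since the sign of a site does not see the site
  itself. So the product of the two flips is the projection to the kets with \<open>r\<^sub>i = b\<close>.
\<close>

lemma flip_twice:
  assumes "i \<in> {1..n}" "b = 0 \<or> b = 1" "r \<in> occupation n"
  shows "flip n b i (flip n b i (ket r)) = 0"
    and "flip n (1 - b) i (flip n b i (ket r)) = (if r i = b then ket r else 0)"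
proof -
  have "r(i := 1 - b) \<in> occupation n"
    using assms by auto
  then show "flip n b i (flip n b i (ket r)) = 0"
    and "flip n (1 - b) i (flip n b i (ket r)) = (if r i = b then ket r else 0)"
    using assms by (auto simp: flip_ket flip_linear fun_upd_idem)
qed

section \<open>The ground field\<close>

text \<open>
  Powers of the variable are monomials, so no positive power of \<open>q\<^sup>1\<^sup>/\<^sup>2\<close> equals \<open>1\<close>; this is what
  makes the denominators \<open>q - q\<^sup>-\<^sup>1\<close> and \<open>q\<^sup>1\<^sup>/\<^sup>2 - q\<^sup>-\<^sup>1\<^sup>/\<^sup>2\<close> nonzero.
\<close>

lemma qh_power: "qh ^ k = Fract (monom 1 k) 1"
proof (induction k)
  case 0
  then show ?case by (simp add: One_fract_def)
next
  case (Suc k)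
  have "[:0, 1:] * monom 1 k = (monom 1 (Suc k) :: complex poly)"
    by (simp add: monom_Suc)
  with Suc show ?case by (simp add: qh_def)
qed

lemma qh_power_neq_1: "k > 0 \<Longrightarrow> qh ^ k \<noteq> 1"
  by (auto simp: qh_power One_fract_def eq_fract monom_eq_1_iff)

lemma qh_nonzero [simp]: "qh \<noteq> 0"
  using qh_power_neq_1[of 1] by (auto simp: qh_def Zero_fract_def eq_fract)

lemma q_nonzero [simp]: "q \<noteq> 0"
  by (simp add: q_def)

lemma qh_square: "qh * qh = q"
  by (simp add: q_def power2_eq_square)

lemma qh_neq_inverse [simp]: "qh \<noteq> inverse qh"
proof
  assume "qh = inverse qh"
  then have "qh * qh = 1"
    by (simp add: field_simps)
  with qh_power_neq_1[of 2] show False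
    by (simp add: power2_eq_square)
qed

lemma q_neq_inverse [simp]: "q \<noteq> inverse q"
proof
  assume "q = inverse q"
  then have "q * q = 1"
    by (simp add: field_simps)
  with qh_power_neq_1[of 4] show False
    by (simp add: q_def flip: power_add)
qed

lemma iu_square: "iu * iu = - 1"
  by (simp add: iu_def One_fract_def one_pCons)

lemma iu_nonzero [simp]: "iu \<noteq> 0"
  using iu_square by auto

lemma two_neq_zero: "(2 :: qfield) \<noteq> 0"
proof
  assume "(2 :: qfield) = 0"
  moreover have "(2 :: qfield) = Fract (1 + 1) 1"
    unfolding one_add_one[symmetric] One_fract_def by simp
  ultimately have "Fract (1 + 1 :: complex poly) 1 = Fract 0 1"
    by (simp only: Zero_fract_def)
  then show False
    by (simp add: eq_fract)
qed

lemma iu_qh_cancel: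
  "inverse iu * inverse qh * (iu * qh) = 1" "iu * qh * (inverse iu * inverse qh) = 1"
  "inverse iu * inverse qh * (iu * qh * t) = t"
  by (simp_all add: field_simps)

section \<open>Fock space as a module over the Clifford algebra\<close>

lemma cl_gens_iff [simp]:
  "Psi i \<in> cl_gens n \<longleftrightarrow> i \<in> {1..n}" "Psid i \<in> cl_gens n \<longleftrightarrow> i \<in> {1..n}"
  "V i \<in> cl_gens n \<longleftrightarrow> i \<in> {1..n}" "Vinv i \<in> cl_gens n \<longleftrightarrow> i \<in> {1..n}"
  by (auto simp: cl_gens_def)

lemma cl_action_closed: "cl_action n \<in> cl_gens n \<rightarrow> carrier (End_algebra (fock_space n))"
proof
  fix g assume "g \<in> cl_gens n"
  then show "cl_action n g \<in> carrier (End_algebra (fock_space n))"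
    by (cases g) (auto simp del: cl_action.simps(3,4) simp: cl_action_flip intro!: linear_extension_closed)
qed

lemma cl_action_V_ket:
  "r \<in> occupation n \<Longrightarrow> cl_action n (V i) (ket r) = pm_scale (inverse q ^ r i) (ket r)"
  "r \<in> occupation n \<Longrightarrow> cl_action n (Vinv i) (ket r) = pm_scale (q ^ r i) (ket r)"
  by (simp_all add: linear_extension_ket)

lemma presentation_cl: "presentation (cl_gens n) (cl_rel n)"
proof
  fix a b assume "cl_rel n a b"
  then show "a \<in> carrier (free_algebra (cl_gens n)) \<and> b \<in> carrier (free_algebra (cl_gens n))"
    by cases auto
qed

interpretation cl: presentation "cl_gens n" "cl_rel n" for n
  by (rule presentation_cl)

text \<open>
  The anticommutators are those of the flips. In the two deformed relations the products
  \<open>\<psi>\<^sub>i\<psi>\<^sub>i\<^sup>\<dagger>\<close> and \<open>\<psi>\<^sub>i\<^sup>\<dagger>\<psi>\<^sub>i\<close> are the complementary projections to \<open>r\<^sub>i = 0\<close> and \<open>r\<^sub>i = 1\<close>,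
  so the left-hand sides are diagonal with the eigenvalues of \<open>v\<^sub>i\<^sup>-\<^sup>1\<close> and \<open>v\<^sub>i\<close>.
\<close>

lemma cl_relations_on_fock:
  assumes "cl_rel n a b"
  shows "free_eval (End_algebra (fock_space n)) (cl_action n) a
       = free_eval (End_algebra (fock_space n)) (cl_action n) b"
proof (rule End_fock_eqI)
  let ?B = "End_algebra (fock_space n)" and ?ev = "free_eval (End_algebra (fock_space n)) (cl_action n)"
  note ev = fock.free_eval_partial[OF cl_action_closed]
  from cl.relations_closed[OF assms] show "?ev a \<in> carrier ?B" "?ev b \<in> carrier ?B"
    by (auto simp: ev)
  fix r assume r: "r \<in> occupation n"
  have V_linear: "v \<in> fock_space n \<Longrightarrow> cl_action n g (pm_scale c v) = pm_scale c (cl_action n g v)"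
    "v \<in> fock_space n \<Longrightarrow> cl_action n g v \<in> fock_space n"
    "cl_action n g 0 = 0" if "g \<in> cl_gens n" for g c v
    using End_fock_app[OF funcset_mem[OF cl_action_closed that]] by blast+
  note rules = ev compose_def r cl_action_flip cl_action_V_ket V_linear flip_linear
  from assms show "?ev a (ket r) = ?ev b (ket r)"
  proof cases
    case (V_V i j)
    then show ?thesis by (simp add: rules mult.commute del: cl_action.simps)
  next
    case (V_Vinv i)
    then show ?thesis by (simp add: rules power_inverse del: cl_action.simps)
  next
    case (Vinv_V i)
    then show ?thesis by (simp add: rules power_inverse del: cl_action.simps)
  next
    case (V_Psi i j)
    then show ?thesis by (auto simp: rules flip_ket power_inverse simp del: cl_action.simps)
  next
    case (V_Psid i j)
    then show ?thesis by (auto simp: rules flip_ket power_inverse simp del: cl_action.simps)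
  next
    case (Psi_Psi i j)
    then show ?thesis
      by (cases "i = j") (simp_all add: rules flip_anticommute flip_twice del: cl_action.simps)
  next
    case (Psid_Psid i j)
    then show ?thesis
      by (cases "i = j") (simp_all add: rules flip_anticommute flip_twice del: cl_action.simps)
  next
    case (Psi_Psid i j)
    then show ?thesis by (simp add: rules flip_anticommute del: cl_action.simps)
  next
    case (Psi_Psid_q i)
    then show ?thesis
      using flip_twice(2)[of i n 0 r] flip_twice(2)[of i n 1 r] occupation_cases[OF r, of i] r
      by (auto simp: rules simp del: cl_action.simps)
  next
    case (Psi_Psid_q_inv i)
    then show ?thesis
      using flip_twice(2)[of i n 0 r] flip_twice(2)[of i n 1 r] occupation_cases[OF r, of i] r
      by (auto simp: rules simp del: cl_action.simps)
  qed
qed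

interpretation fock_action: respectful_valuation "cl_gens n" "cl_rel n"
    "End_algebra (fock_space n)" "cl_action n" for n
  by unfold_locales (auto simp: cl_relations_on_fock intro: funcset_mem[OF cl_action_closed])

lemma fock_rep_class: "g \<in> cl_gens n \<Longrightarrow> fock_rep n (cl_class n g) = cl_action n g"
  unfolding fock_rep_def cl_class_def by (rule fock_action.induced_hom_gen_class)

lemma fock_rep_algebra_hom: "fock_rep n \<in> algebra_hom (Cl n) (End_algebra (fock_space n))"
  unfolding fock_rep_def Cl_def by (rule fock_action.induced_hom_algebra_hom)

section \<open>Twisted commutators\<close>

context assoc_algebra
begin

lemma diff_smult: "x \<in> carrier A \<Longrightarrow> (c - d) \<odot> x = c \<odot> x \<ominus> d \<odot> x"
  using add_smult[of x c "- d"] by (simp add: minus_smult minus_eq)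

text \<open>
  The operator \<open>Ad\<^sub>e\<close>, with a scalar \<open>s\<close> in place of the sign, so that one computation covers
  the even and the odd generators.
\<close>

definition twisted_ad :: "'a \<Rightarrow> 'a \<Rightarrow> 'a \<Rightarrow> 'k \<Rightarrow> 'a \<Rightarrow> 'a" where
  "twisted_ad e k k' s x = e \<otimes> x \<ominus> s \<odot> (k \<otimes> x \<otimes> k' \<otimes> e)"

lemma conj_mult:
  assumes "k' \<otimes> k = \<one>" and in_A: "k \<in> carrier A" "k' \<in> carrier A" "x \<in> carrier A" "y \<in> carrier A"
  shows "k \<otimes> (x \<otimes> y) \<otimes> k' = (k \<otimes> x \<otimes> k') \<otimes> (k \<otimes> y \<otimes> k')"
proof -
  have "(k \<otimes> x \<otimes> k') \<otimes> (k \<otimes> y \<otimes> k') = k \<otimes> x \<otimes> (k' \<otimes> k) \<otimes> y \<otimes> k'"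
    using in_A by (simp add: m_assoc)
  then show ?thesis
    using assms by (simp add: m_assoc)
qed

lemma conj_inverse:
  assumes "k \<otimes> x \<otimes> k' = a \<odot> x" "a \<noteq> 0" and k: "k' \<otimes> k = \<one>" and in_A: "k \<in> carrier A" "k' \<in> carrier A" "x \<in> carrier A"
  shows "k' \<otimes> x \<otimes> k = inverse a \<odot> x"
proof -
  have "x = (k' \<otimes> k) \<otimes> x \<otimes> (k' \<otimes> k)"
    using in_A k by simp
  also have "\<dots> = k' \<otimes> (k \<otimes> x \<otimes> k') \<otimes> k"
    using in_A by (simp add: m_assoc)
  also have "\<dots> = a \<odot> (k' \<otimes> x \<otimes> k)"
    using in_A by (simp add: assms(1) smult_mult_left smult_mult_right)
  finally have "inverse a \<odot> x = inverse a \<odot> (a \<odot> (k' \<otimes> x \<otimes> k))"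
    by simp
  then show ?thesis
    using assms by (simp add: smult_smult)
qed

lemma cancel_middle:
  assumes "x \<otimes> y = \<one>" "a \<otimes> b = \<one>" "x \<in> carrier A" "y \<in> carrier A" "a \<in> carrier A" "b \<in> carrier A"
  shows "(a \<otimes> x) \<otimes> (y \<otimes> b) = \<one>"
proof -
  have "(a \<otimes> x) \<otimes> (y \<otimes> b) = a \<otimes> (x \<otimes> y) \<otimes> b"
    using assms(3-) by (simp add: m_assoc)
  then show ?thesis using assms by simp
qed

lemma commute_mult:
  assumes "x \<otimes> y = y \<otimes> x" "x \<otimes> z = z \<otimes> x" "x \<in> carrier A" "y \<in> carrier A" "z \<in> carrier A"
  shows "x \<otimes> (y \<otimes> z) = (y \<otimes> z) \<otimes> x"
  using assms by (metis m_assoc)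

lemma smult_eq_zeroD: "x \<in> carrier A \<Longrightarrow> c \<odot> x = \<zero> \<Longrightarrow> c \<noteq> 0 \<Longrightarrow> x = \<zero>"
  by (metis left_inverse one_smult smult_smult smult_zero)

context
  fixes e k k' x :: 'a and a d :: 'k
  assumes in_A [simp]: "e \<in> carrier A" "k \<in> carrier A" "k' \<in> carrier A" "x \<in> carrier A"
    and k'k: "k' \<otimes> k = \<one>"
    and wt_x: "k \<otimes> x \<otimes> k' = a \<odot> x" and wt_e: "k \<otimes> e \<otimes> k' = d \<odot> e"
    and ee: "e \<otimes> e = \<zero>"
begin

lemma ee': "y \<in> carrier A \<Longrightarrow> e \<otimes> (e \<otimes> y) = \<zero>"
  using ee by (simp flip: m_assoc)

text \<open>
  Of the four terms of the double application, the two with \<open>e \<otimes> e\<close> at an end vanish, and the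
  other two are multiples of \<open>e \<otimes> x \<otimes> e\<close>. So the Serre relations of degree two reduce to
  \<open>e \<otimes> x \<otimes> e = \<zero>\<close>, and those of degree three hold because \<open>e \<otimes> e = \<zero>\<close>.
\<close>

lemma twisted_ad_twice:
  "twisted_ad e k k' s1 (twisted_ad e k k' s0 x) = (- (s0 * a + s1 * (a * d))) \<odot> (e \<otimes> x \<otimes> e)"
proof -
  \<comment> \<open>\<open>x1\<close> is again a weight vector, of weight the product of those of \<open>e\<close> and \<open>x\<close>.\<close>
  define x1 where "x1 = twisted_ad e k k' s0 x"
  have x1: "x1 = e \<otimes> x \<oplus> (- (s0 * a)) \<odot> (x \<otimes> e)"
    by (simp add: x1_def twisted_ad_def wt_x smult_mult_left smult_smult minus_smult minus_eq)
  have "k \<otimes> x1 \<otimes> k' = k \<otimes> (e \<otimes> x) \<otimes> k' \<oplus> (- (s0 * a)) \<odot> (k \<otimes> (x \<otimes> e) \<otimes> k')"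
    by (simp add: x1 l_distr r_distr smult_mult_left smult_mult_right)
  also have "\<dots> = (a * d) \<odot> x1"
    by (simp add: conj_mult[OF k'k] wt_x wt_e smult_mult_left smult_mult_right smult_smult x1
        smult_add mult_ac)
  finally have wt_x1: "k \<otimes> x1 \<otimes> k' = (a * d) \<odot> x1" .
  have "x1 \<in> carrier A"
    by (simp add: x1)
  then have "twisted_ad e k k' s1 x1 = e \<otimes> x1 \<ominus> (s1 * (a * d)) \<odot> (x1 \<otimes> e)"
    by (simp add: twisted_ad_def wt_x1 smult_mult_left smult_smult)
  also have "\<dots> = e \<otimes> x1 \<oplus> (- (s1 * (a * d))) \<odot> (x1 \<otimes> e)"
    using \<open>x1 \<in> carrier A\<close> by (simp add: minus_smult minus_eq)
  also have "\<dots> = (- (s0 * a)) \<odot> (e \<otimes> x \<otimes> e) \<oplus> (- (s1 * (a * d))) \<odot> (e \<otimes> x \<otimes> e)"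
    by (simp add: x1 l_distr r_distr smult_mult_left smult_mult_right m_assoc ee ee')
  also have "\<dots> = (- (s0 * a + s1 * (a * d))) \<odot> (e \<otimes> x \<otimes> e)"
    by (simp flip: add_smult)
  finally show ?thesis by (simp add: x1_def)
qed

lemma twisted_ad_thrice:
  "twisted_ad e k k' s2 (twisted_ad e k k' s1 (twisted_ad e k k' s0 x)) = \<zero>"
proof -
  have "k \<otimes> (e \<otimes> x \<otimes> e) \<otimes> k' = (d * (a * d)) \<odot> (e \<otimes> x \<otimes> e)"
    by (simp add: conj_mult[OF k'k] wt_x wt_e smult_mult_left smult_mult_right smult_smult mult_ac)
  then have "twisted_ad e k k' s2 (t \<odot> (e \<otimes> x \<otimes> e)) = \<zero>" for t
    by (simp add: twisted_ad_def smult_mult_left smult_mult_right m_assoc ee ee' minus_eq)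
  then show ?thesis by (simp add: twisted_ad_twice)
qed

end

end

section \<open>Systems of deformed Clifford generators\<close>

text \<open>
  The computations in the deformed Clifford algebra use only its relations. The letter
  \<open>c True i\<close> stands for \<open>\<psi>\<^sub>i\<close>, \<open>c False i\<close> for \<open>\<psi>\<^sub>i\<^sup>\<dagger>\<close>, and \<open>w i\<close> for \<open>v\<^sub>i\<^sup>-\<^sup>1\<close>. A Boolean
  index lets positive and negative root vectors be treated together.
\<close>

locale clifford_system = assoc_algebra A for A :: "(qfield, 'a) module" (structure) +
  fixes n :: nat and c :: "bool \<Rightarrow> nat \<Rightarrow> 'a" and v w :: "nat \<Rightarrow> 'a"
  assumes c_closed [simp]: "i \<in> {1..n} \<Longrightarrow> c b i \<in> carrier A"
    and v_closed [simp]: "i \<in> {1..n} \<Longrightarrow> v i \<in> carrier A"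
    and w_closed [simp]: "i \<in> {1..n} \<Longrightarrow> w i \<in> carrier A"
    and v_v: "i \<in> {1..n} \<Longrightarrow> j \<in> {1..n} \<Longrightarrow> v i \<otimes> v j = v j \<otimes> v i"
    and v_w: "i \<in> {1..n} \<Longrightarrow> v i \<otimes> w i = \<one>"
    and w_v: "i \<in> {1..n} \<Longrightarrow> w i \<otimes> v i = \<one>"
    and v_c: "i \<in> {1..n} \<Longrightarrow> j \<in> {1..n} \<Longrightarrow>
      v i \<otimes> c b j \<otimes> w i = (if i = j then if b then q else inverse q else 1) \<odot> c b j"
    and anticommute: "i \<in> {1..n} \<Longrightarrow> j \<in> {1..n} \<Longrightarrow> i \<noteq> j \<or> b = b' \<Longrightarrow>
      c b i \<otimes> c b' j \<oplus> c b' j \<otimes> c b i = \<zero>"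
    and c_c_w: "i \<in> {1..n} \<Longrightarrow> c True i \<otimes> c False i \<oplus> q \<odot> (c False i \<otimes> c True i) = w i"
    and c_c_v: "i \<in> {1..n} \<Longrightarrow> c True i \<otimes> c False i \<oplus> inverse q \<odot> (c False i \<otimes> c True i) = v i"
begin

primrec monomial :: "(bool \<times> nat) list \<Rightarrow> 'a" where
  "monomial [] = \<one>"
| "monomial (x # L) = c (fst x) (snd x) \<otimes> monomial L"

abbreviation on_sites :: "(bool \<times> nat) list \<Rightarrow> bool" where
  "on_sites L \<equiv> \<forall>x\<in>set L. snd x \<in> {1..n}"

text \<open>
  Only the pair \<open>\<psi>\<^sub>i, \<psi>\<^sub>i\<^sup>\<dagger>\<close> at a common site fails to anticommute.
\<close>

definition anticommuting :: "bool \<times> nat \<Rightarrow> bool \<times> nat \<Rightarrow> bool" where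
  "anticommuting x y \<longleftrightarrow> snd x \<noteq> snd y \<or> fst x = fst y"

lemma monomial_closed [simp]: "on_sites L \<Longrightarrow> monomial L \<in> carrier A"
  by (induction L) (auto simp del: atLeastAtMost_iff)

lemma monomial_append:
  "on_sites L \<Longrightarrow> on_sites M \<Longrightarrow> monomial (L @ M) = monomial L \<otimes> monomial M"
  by (induction L) (auto simp: m_assoc simp del: atLeastAtMost_iff)

lemma letters_swap:
  assumes "i \<in> {1..n}" "j \<in> {1..n}" "i \<noteq> j \<or> b = b'"
  shows "c b i \<otimes> c b' j = (- 1) \<odot> (c b' j \<otimes> c b i)"
  using minus_equality[OF anticommute[OF assms]] assms by (simp add: minus_smult)

lemma letter_swap:
  assumes "snd x \<in> {1..n}" "on_sites M" "\<forall>y\<in>set M. anticommuting x y"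
  shows "c (fst x) (snd x) \<otimes> monomial M = (- 1) ^ length M \<odot> (monomial M \<otimes> c (fst x) (snd x))"
  using assms(2,3)
proof (induction M)
  case Nil
  then show ?case using assms by simp
next
  case (Cons y M)
  let ?x = "c (fst x) (snd x)" and ?y = "c (fst y) (snd y)"
  have in_A: "?x \<in> carrier A" "?y \<in> carrier A" "monomial M \<in> carrier A"
    using Cons.prems assms(1) by auto
  have "?x \<otimes> ?y = (- 1) \<odot> (?y \<otimes> ?x)"
    using Cons.prems assms(1) by (intro letters_swap) (auto simp: anticommuting_def)
  then have "?x \<otimes> (?y \<otimes> monomial M) = (- 1) \<odot> (?y \<otimes> (?x \<otimes> monomial M))"
    using in_A by (simp add: smult_mult_left flip: m_assoc)
  also have "\<dots> = (- 1) ^ length (y # M) \<odot> (?y \<otimes> monomial M \<otimes> ?x)"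
    using Cons in_A by (simp add: smult_mult_right smult_smult m_assoc)
  finally show ?case by simp
qed

text \<open>
  Moving each letter of \<open>L\<close> across each letter of \<open>M\<close> costs one sign.
\<close>

lemma monomial_swap:
  assumes "on_sites L" "on_sites M" "\<forall>x\<in>set L. \<forall>y\<in>set M. anticommuting x y"
  shows "monomial L \<otimes> monomial M = (- 1) ^ (length L * length M) \<odot> (monomial M \<otimes> monomial L)"
  using assms(1,3)
proof (induction L)
  case Nil
  then show ?case using assms by simp
next
  case (Cons x L)
  let ?x = "c (fst x) (snd x)"
  have in_A: "?x \<in> carrier A" "monomial L \<in> carrier A" "monomial M \<in> carrier A"
    using Cons.prems assms(2) by auto
  have "?x \<otimes> monomial L \<otimes> monomial M = (- 1) ^ (length L * length M) \<odot> (?x \<otimes> monomial M \<otimes> monomial L)"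
    using Cons in_A by (simp add: m_assoc smult_mult_right)
  also have "?x \<otimes> monomial M = (- 1) ^ length M \<odot> (monomial M \<otimes> ?x)"
    using Cons.prems assms by (intro letter_swap) auto
  finally show ?case
    using in_A by (simp add: smult_mult_left smult_smult power_add m_assoc mult.commute)
qed

text \<open>
  A letter anticommutes with itself, and \<open>2\<close> is invertible.
\<close>

lemma letter_square: "i \<in> {1..n} \<Longrightarrow> c b i \<otimes> c b i = \<zero>"
  using anticommute[of i i b b] smult_eq_zeroD[of "c b i \<otimes> c b i" 2]
    add_smult[of "c b i \<otimes> c b i" 1 1] two_neq_zero
  by simp

text \<open>
  The second copy of the letter is moved to the first one, where the square vanishes. This is
  the source of all vanishing products of root vectors.
\<close>

lemma monomial_repeated_letter:
  assumes "on_sites (L @ x # M @ x # N)" "\<forall>y\<in>set M. anticommuting x y"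
  shows "monomial (L @ x # M @ x # N) = \<zero>"
proof -
  let ?x = "c (fst x) (snd x)"
  have in_A: "?x \<in> carrier A" "monomial L \<in> carrier A" "monomial M \<in> carrier A" "monomial N \<in> carrier A"
    using assms(1) by auto
  have "?x \<otimes> (monomial M \<otimes> (?x \<otimes> monomial N)) = (?x \<otimes> monomial M) \<otimes> (?x \<otimes> monomial N)"
    using in_A by (simp add: m_assoc)
  also have "?x \<otimes> monomial M = (- 1) ^ length M \<odot> (monomial M \<otimes> ?x)"
    using assms by (intro letter_swap) auto
  also have "\<dots> \<otimes> (?x \<otimes> monomial N) = (- 1) ^ length M \<odot> (monomial M \<otimes> ((?x \<otimes> ?x) \<otimes> monomial N))"
    using in_A by (simp add: smult_mult_left m_assoc)
  also have "?x \<otimes> ?x = \<zero>"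
    using assms(1) by (intro letter_square) auto
  finally have "?x \<otimes> (monomial M \<otimes> (?x \<otimes> monomial N)) = \<zero>"
    using in_A by simp
  then show ?thesis
    using assms(1) in_A by (subst monomial_append) (auto simp: monomial_append)
qed

definition letter_weight :: "nat \<Rightarrow> bool \<times> nat \<Rightarrow> qfield" where
  "letter_weight i x = (if i = snd x then if fst x then q else inverse q else 1)"

lemma letter_weight_nonzero [simp]: "letter_weight i x \<noteq> 0"
  by (simp add: letter_weight_def)

lemma v_letter:
  assumes "i \<in> {1..n}" "snd x \<in> {1..n}"
  shows "v i \<otimes> c (fst x) (snd x) \<otimes> w i = letter_weight i x \<odot> c (fst x) (snd x)"
    and "w i \<otimes> c (fst x) (snd x) \<otimes> v i = inverse (letter_weight i x) \<odot> c (fst x) (snd x)"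
proof -
  show *: "v i \<otimes> c (fst x) (snd x) \<otimes> w i = letter_weight i x \<odot> c (fst x) (snd x)"
    using v_c[of i "snd x" "fst x"] assms by (simp add: letter_weight_def)
  show "w i \<otimes> c (fst x) (snd x) \<otimes> v i = inverse (letter_weight i x) \<odot> c (fst x) (snd x)"
    by (rule conj_inverse[OF *]) (use assms w_v in auto)
qed

text \<open>
  The letters of \<open>\<psi>\<^sub>i\<psi>\<^sub>i\<^sub>+\<^sub>1\<^sup>\<dagger>\<close> for \<open>b = True\<close> and of \<open>\<psi>\<^sub>i\<^sup>\<dagger>\<psi>\<^sub>i\<^sub>+\<^sub>1\<close> for \<open>b = False\<close>; at
  \<open>i = n\<close> the factor at the site \<open>n + 1\<close> is dropped. Up to scalars these monomials are the images
  of \<open>e\<^sub>i\<close> and \<open>f\<^sub>i\<close>.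
\<close>

definition root_letters :: "bool \<Rightarrow> nat \<Rightarrow> (bool \<times> nat) list" where
  "root_letters b i = (if i = n then [(b, n)] else [(b, i), (\<not> b, i + 1)])"

definition root_vector :: "bool \<Rightarrow> nat \<Rightarrow> 'a" where
  "root_vector b i = monomial (root_letters b i)"

text \<open>
  The images of \<open>k\<^sub>i\<close> and \<open>k\<^sub>i\<^sup>-\<^sup>1\<close>.
\<close>

definition k_gen :: "nat \<Rightarrow> 'a" where
  "k_gen i = (if i = n then (iu * qh) \<odot> v n else v i \<otimes> w (i + 1))"

definition k_gen_inv :: "nat \<Rightarrow> 'a" where
  "k_gen_inv i = (if i = n then inverse (iu * qh) \<odot> w n else v (i + 1) \<otimes> w i)"

lemma root_letters_on_sites [simp]: "i \<in> {1..n} \<Longrightarrow> on_sites (root_letters b i)"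
  by (auto simp: root_letters_def)

lemma root_vector_closed [simp]: "i \<in> {1..n} \<Longrightarrow> root_vector b i \<in> carrier A"
  unfolding root_vector_def by (rule monomial_closed) (rule root_letters_on_sites)

lemma k_gen_closed [simp]: "i \<in> {1..n} \<Longrightarrow> k_gen i \<in> carrier A" "i \<in> {1..n} \<Longrightarrow> k_gen_inv i \<in> carrier A"
  by (auto simp: k_gen_def k_gen_inv_def)

lemma k_gen_inverse: "i \<in> {1..n} \<Longrightarrow> k_gen i \<otimes> k_gen_inv i = \<one>" "i \<in> {1..n} \<Longrightarrow> k_gen_inv i \<otimes> k_gen i = \<one>"
  by (auto simp: k_gen_def k_gen_inv_def smult_mult_left smult_mult_right smult_smult v_w w_v cancel_middle iu_qh_cancel)

lemma v_w_commute: "i \<in> {1..n} \<Longrightarrow> j \<in> {1..n} \<Longrightarrow> v i \<otimes> w j = w j \<otimes> v i"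
proof -
  assume *: "i \<in> {1..n}" "j \<in> {1..n}"
  \<comment> \<open>Conjugating \<open>v\<^sub>i\<close> by \<open>v\<^sub>j\<close> does not change it.\<close>
  have "w j \<otimes> v i = w j \<otimes> (v i \<otimes> v j) \<otimes> w j"
    using * by (simp add: m_assoc v_w)
  also have "\<dots> = (w j \<otimes> v j) \<otimes> v i \<otimes> w j"
    using * by (subst v_v) (auto simp: m_assoc)
  finally show ?thesis using * by (simp add: w_v)
qed

lemma w_w: "i \<in> {1..n} \<Longrightarrow> j \<in> {1..n} \<Longrightarrow> w i \<otimes> w j = w j \<otimes> w i"
proof -
  assume *: "i \<in> {1..n}" "j \<in> {1..n}"
  have "w j \<otimes> w i = w j \<otimes> (w i \<otimes> v j) \<otimes> w j"
    using * by (simp add: m_assoc v_w)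
  also have "\<dots> = (w j \<otimes> v j) \<otimes> w i \<otimes> w j"
    using * by (subst v_w_commute[symmetric]) (auto simp: m_assoc)
  finally show ?thesis using * by (simp add: w_v)
qed

lemma k_gen_commute: "i \<in> {1..n} \<Longrightarrow> j \<in> {1..n} \<Longrightarrow> k_gen i \<otimes> k_gen j = k_gen j \<otimes> k_gen i"
proof -
  assume *: "i \<in> {1..n}" "j \<in> {1..n}"
  have v: "v l \<otimes> k_gen j = k_gen j \<otimes> v l" and w: "w l \<otimes> k_gen j = k_gen j \<otimes> w l" if "l \<in> {1..n}" for l
    using that * by (auto simp: k_gen_def smult_mult_left smult_mult_right v_v v_w_commute[symmetric] w_w
      intro!: commute_mult v_v w_w v_w_commute v_w_commute[symmetric])
  show ?thesis
    using * commute_mult[of "k_gen j" "v i" "w (i + 1)"] v w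
    by (cases "i = n") (auto simp: k_gen_def[of i] k_gen_def[of n] smult_mult_left smult_mult_right)
qed

text \<open>
  The eigenvalue of conjugation by \<open>k_gen i\<close> on a single letter; the scalar \<open>\<surd>-1 q\<^sup>1\<^sup>/\<^sup>2\<close> in the
  image of \<open>k\<^sub>n\<close> cancels in a conjugation.
\<close>

definition root_weight :: "nat \<Rightarrow> bool \<times> nat \<Rightarrow> qfield" where
  "root_weight i x = letter_weight i x * (if i = n then 1 else inverse (letter_weight (i + 1) x))"

lemma k_gen_letter:
  assumes i: "i \<in> {1..n}" and x: "snd x \<in> {1..n}"
  shows "k_gen i \<otimes> c (fst x) (snd x) \<otimes> k_gen_inv i = root_weight i x \<odot> c (fst x) (snd x)"
proof (cases "i = n")
  case True
  then show ?thesis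
    using assms v_letter(1)[of n x]
    by (simp add: k_gen_def k_gen_inv_def root_weight_def smult_mult_left smult_mult_right smult_smult iu_qh_cancel)
next
  case False
  then have i': "i + 1 \<in> {1..n}" using i by auto
  have "k_gen i \<otimes> c (fst x) (snd x) \<otimes> k_gen_inv i =
      v i \<otimes> (w (i + 1) \<otimes> c (fst x) (snd x) \<otimes> v (i + 1)) \<otimes> w i"
    using False i i' x by (simp add: k_gen_def k_gen_inv_def m_assoc)
  also have "\<dots> = root_weight i x \<odot> c (fst x) (snd x)"
    unfolding v_letter(2)[OF i' x] using False i x v_letter(1)[OF i x]
    by (simp add: root_weight_def smult_mult_left smult_mult_right smult_smult mult.commute)
  finally show ?thesis .
qed

lemma k_gen_monomial:
  assumes i: "i \<in> {1..n}" and L: "on_sites L"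
  shows "k_gen i \<otimes> monomial L \<otimes> k_gen_inv i = (\<Prod>x\<leftarrow>L. root_weight i x) \<odot> monomial L"
  using L
proof (induction L)
  case Nil
  then show ?case using i by (simp add: k_gen_inverse)
next
  case (Cons x L)
  then show ?case
    using i k_gen_letter[OF i, of x]
    by (simp add: conj_mult[OF k_gen_inverse(2)[OF i]] smult_mult_left smult_mult_right smult_smult
        mult.commute)
qed

text \<open>
  Conjugation is multiplicative, so a monomial is scaled by the product of the weights of its
  letters. For a root vector the product depends only on which sites \<open>i\<close>, \<open>i + 1\<close> and \<open>j\<close>, \<open>j + 1\<close>
  coincide, and on whether \<open>i\<close> or \<open>j\<close> is \<open>n\<close>.
\<close>

lemma k_gen_root_vector:
  assumes i: "i \<in> {1..n}" and j: "j \<in> {1..n}"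
  shows "k_gen i \<otimes> root_vector b j \<otimes> k_gen_inv i =
    (qi n i powi (if b then cartan n i j else - cartan n i j)) \<odot> root_vector b j"
proof -
  have "(\<Prod>x\<leftarrow>root_letters b j. root_weight i x) =
      qi n i powi (if b then cartan n i j else - cartan n i j)"
    using i j by (auto simp: root_letters_def root_weight_def letter_weight_def cartan_def qi_def
        power_int_minus power_inverse q_def power2_eq_square)
  then show ?thesis
    unfolding root_vector_def using k_gen_monomial[OF i root_letters_on_sites[OF j]] by simp
qed

lemma root_vector_square: "i \<in> {1..n} \<Longrightarrow> root_vector b i \<otimes> root_vector b i = \<zero>"
  using monomial_repeated_letter[of "[]" "(b, n)" "[]" "[]"]
    monomial_repeated_letter[of "[]" "(b, i)" "[(\<not> b, i + 1)]" "[(\<not> b, i + 1)]"]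
  by (auto simp: root_vector_def root_letters_def anticommuting_def m_assoc)

text \<open>
  The sites of the two monomials are disjoint, and since at most one of \<open>i\<close> and \<open>j\<close> equals \<open>n\<close>, one
  of the monomials has two letters; so the number of sign changes is even.
\<close>

lemma root_vector_commute:
  assumes "i \<in> {1..n}" "j \<in> {1..n}" "i + 1 < j \<or> j + 1 < i"
  shows "root_vector b i \<otimes> root_vector b' j = root_vector b' j \<otimes> root_vector b i"
proof -
  have "(- 1 :: qfield) ^ (length (root_letters b i) * length (root_letters b' j)) = 1"
    using assms by (auto simp: root_letters_def)
  moreover have "\<forall>x\<in>set (root_letters b i). \<forall>y\<in>set (root_letters b' j). anticommuting x y"
    using assms by (auto simp: root_letters_def anticommuting_def)
  ultimately have "root_vector b i \<otimes> root_vector b' j = 1 \<odot> (root_vector b' j \<otimes> root_vector b i)"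
    using monomial_swap[OF root_letters_on_sites[OF assms(1)] root_letters_on_sites[OF assms(2)]]
    unfolding root_vector_def by metis
  then show ?thesis
    using assms by simp
qed

text \<open>
  Neighbouring root vectors of opposite sign share a letter, namely the one at their common
  site, and the two copies are separated by anticommuting letters at most.
\<close>

lemma root_vector_opposite_zero:
  assumes "i \<in> {1..n}" "j \<in> {1..n}" "j = i + 1 \<or> i = j + 1"
  shows "root_vector b i \<otimes> root_vector (\<not> b) j = \<zero>"
proof -
  have "monomial (root_letters b i @ root_letters (\<not> b) j) = \<zero>"
  proof (cases "j = i + 1")
    case True
    let ?R = "if j = n then [] else [(b, j + 1)]"
    have "root_letters b i @ root_letters (\<not> b) j = [(b, i)] @ (\<not> b, j) # [] @ (\<not> b, j) # ?R"
      using True assms by (auto simp: root_letters_def)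
    then show ?thesis
      using True assms by (simp only:) (rule monomial_repeated_letter, auto)
  next
    case False
    let ?R = "if i = n then [] else [(\<not> b, i + 1)]"
    have "root_letters b i @ root_letters (\<not> b) j = [] @ (b, i) # (?R @ [(\<not> b, j)]) @ (b, i) # []"
      using False assms by (auto simp: root_letters_def)
    then show ?thesis
      using False assms by (simp only:) (rule monomial_repeated_letter, auto simp: anticommuting_def)
  qed
  then show ?thesis
    using root_letters_on_sites[OF assms(1)] root_letters_on_sites[OF assms(2)]
    by (simp add: root_vector_def monomial_append)
qed

text \<open>
  A root vector with \<open>i < n\<close> has a letter at a site that its neighbour does not touch. The two
  copies of this letter in the product are separated by letters which anticommute with it.
\<close>

lemma root_vector_sandwich:
  assumes "i \<in> {1..n}" "j \<in> {1..n}" "j = i + 1 \<or> i = j + 1" "i \<noteq> n"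
  shows "root_vector b i \<otimes> root_vector b j \<otimes> root_vector b i = \<zero>"
proof -
  have "monomial (root_letters b i @ root_letters b j @ root_letters b i) = \<zero>"
  proof (cases "j = i + 1")
    case True
    \<comment> \<open>The right neighbour does not touch the site \<open>i\<close>.\<close>
    have "root_letters b i @ root_letters b j @ root_letters b i
        = [] @ (b, i) # ((\<not> b, j) # root_letters b j) @ (b, i) # [(\<not> b, j)]"
      using True assms by (auto simp: root_letters_def)
    then show ?thesis
      using True assms
      by (simp only:) (rule monomial_repeated_letter, auto simp: anticommuting_def root_letters_def)
  next
    case False
    \<comment> \<open>The left neighbour does not touch the site \<open>i + 1\<close>.\<close>
    have "root_letters b i @ root_letters b j @ root_letters b i
        = [(b, i)] @ (\<not> b, i + 1) # (root_letters b j @ [(b, i)]) @ (\<not> b, i + 1) # []"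
      using False assms by (auto simp: root_letters_def)
    then show ?thesis
      using False assms
      by (simp only:) (rule monomial_repeated_letter, auto simp: anticommuting_def root_letters_def)
  qed
  then show ?thesis
    using root_letters_on_sites[OF assms(1)] root_letters_on_sites[OF assms(2)]
    by (subst (asm) monomial_append, blast, force)
      (subst (asm) monomial_append, blast, blast, simp add: root_vector_def m_assoc)
qed

text \<open>
  With \<open>a = \<psi>\<^sub>i\<psi>\<^sub>i\<^sup>\<dagger>\<close>, \<open>b = \<psi>\<^sub>i\<^sup>\<dagger>\<psi>\<^sub>i\<close> and the same products \<open>a'\<close>, \<open>b'\<close> at the site
  \<open>i + 1\<close>, the left-hand side is \<open>a \<otimes> b' \<ominus> b \<otimes> a'\<close>. The deformed relations express \<open>v\<close> and its
  inverse by \<open>a\<close> and \<open>b\<close>, and in \<open>v\<^sub>iv\<^sub>i\<^sub>+\<^sub>1\<^sup>-\<^sup>1 - v\<^sub>i\<^sup>-\<^sup>1v\<^sub>i\<^sub>+\<^sub>1\<close> the terms \<open>a \<otimes> a'\<close> and \<open>b \<otimes> b'\<close>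
  cancel.
\<close>

lemma even_commutator:
  assumes i: "i \<in> {1..n}" "i \<noteq> n"
  shows "c True i \<otimes> c False (i + 1) \<otimes> (c True (i + 1) \<otimes> c False i)
      \<ominus> c True (i + 1) \<otimes> c False i \<otimes> (c True i \<otimes> c False (i + 1))
    = (1 / (q - inverse q)) \<odot> (k_gen i \<ominus> k_gen_inv i)"
proof -
  have i': "i + 1 \<in> {1..n}" using i by auto
  define a b a' b' where "a = monomial [(True, i), (False, i)]"
    and "b = monomial [(False, i), (True, i)]"
    and "a' = monomial [(True, i + 1), (False, i + 1)]"
    and "b' = monomial [(False, i + 1), (True, i + 1)]"
  have in_A [simp]: "a \<in> carrier A" "b \<in> carrier A" "a' \<in> carrier A" "b' \<in> carrier A"
    using i i' by (simp_all add: a_def b_def a'_def b'_def)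
  have swap: "monomial [(x, i + 1), (y, i + 1)] \<otimes> monomial [(z, i), (u, i)]
      = monomial [(z, i), (u, i)] \<otimes> monomial [(x, i + 1), (y, i + 1)]" for x y z u
    using i i' by (subst monomial_swap) (simp_all add: anticommuting_def)
  have commute: "a' \<otimes> a = a \<otimes> a'" "b' \<otimes> a = a \<otimes> b'" "a' \<otimes> b = b \<otimes> a'" "b' \<otimes> b = b \<otimes> b'"
    unfolding a_def b_def a'_def b'_def by (rule swap)+
  have ef: "c True i \<otimes> c False (Suc i) \<otimes> (c True (Suc i) \<otimes> c False i) = a \<otimes> b'"
  proof -
    have "c True i \<otimes> (monomial [(False, Suc i), (True, Suc i)] \<otimes> monomial [(False, i)]) =
        c True i \<otimes> (monomial [(False, i)] \<otimes> monomial [(False, Suc i), (True, Suc i)])"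
      using i i' by (subst monomial_swap) (simp_all add: anticommuting_def)
    then show ?thesis
      using i i' by (simp add: a_def b'_def m_assoc)
  qed
  have fe: "c True (Suc i) \<otimes> c False i \<otimes> (c True i \<otimes> c False (Suc i)) = b \<otimes> a'"
  proof -
    have "monomial [(True, Suc i)] \<otimes> monomial [(False, i), (True, i)] \<otimes> c False (Suc i) =
        monomial [(False, i), (True, i)] \<otimes> monomial [(True, Suc i)] \<otimes> c False (Suc i)"
      using i i' by (subst monomial_swap) (simp_all add: anticommuting_def)
    then show ?thesis
      using i i' by (simp add: b_def a'_def m_assoc)
  qed
  have v: "v i = a \<oplus> inverse q \<odot> b" "v (Suc i) = a' \<oplus> inverse q \<odot> b'"
    and w: "w i = a \<oplus> q \<odot> b" "w (Suc i) = a' \<oplus> q \<odot> b'"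
    using c_c_v[OF i(1)] c_c_v[OF i'] c_c_w[OF i(1)] c_c_w[OF i'] i i'
    by (simp_all add: a_def b_def a'_def b'_def)
  have k_gen: "k_gen i = a \<otimes> a' \<oplus> b \<otimes> b' \<oplus> (q \<odot> (a \<otimes> b') \<oplus> inverse q \<odot> (b \<otimes> a'))"
    using i by (simp add: k_gen_def v w l_distr r_distr smult_mult_left smult_mult_right smult_smult
        smult_add a_ac)
  have k_gen_inv: "k_gen_inv i = a \<otimes> a' \<oplus> b \<otimes> b' \<oplus> (q \<odot> (b \<otimes> a') \<oplus> inverse q \<odot> (a \<otimes> b'))"
    using i by (simp add: k_gen_inv_def v w l_distr r_distr smult_mult_left smult_mult_right smult_smult
        smult_add a_ac commute)
  have "k_gen i \<ominus> k_gen_inv i = (q - inverse q) \<odot> (a \<otimes> b') \<oplus> (inverse q - q) \<odot> (b \<otimes> a')"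
    unfolding k_gen k_gen_inv minus_add_distrib
    by (simp add: diff_smult smult_minus minus_eq minus_add a_ac r_neg r_neg1 r_neg2)
  also have "\<dots> = (q - inverse q) \<odot> (a \<otimes> b' \<ominus> b \<otimes> a')"
    using minus_smult[of "b \<otimes> a'" "q - inverse q"]
    by (simp add: minus_eq smult_add smult_minus)
  finally show ?thesis
    by (simp add: ef fe smult_smult)
qed

text \<open>
  Here the inverse of \<open>\<surd>-1 q\<^sup>1\<^sup>/\<^sup>2\<close> is \<open>- \<surd>-1 q\<^sup>-\<^sup>1\<^sup>/\<^sup>2\<close>, which turns the difference \<open>k\<^sub>n - k\<^sub>n\<^sup>-\<^sup>1\<close> into
  a sum. The sum is a multiple of \<open>\<psi>\<^sub>n\<psi>\<^sub>n\<^sup>\<dagger> + \<psi>\<^sub>n\<^sup>\<dagger>\<psi>\<^sub>n\<close> because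
  \<open>(q\<^sup>1\<^sup>/\<^sup>2 - q\<^sup>-\<^sup>1\<^sup>/\<^sup>2)(q\<^sup>1\<^sup>/\<^sup>2 + q\<^sup>-\<^sup>1\<^sup>/\<^sup>2) = q - q\<^sup>-\<^sup>1\<close>.
\<close>

lemma odd_commutator:
  assumes n: "n \<ge> 1"
  shows "(iu / (qh - inverse qh)) \<odot> (c True n \<otimes> c False n \<oplus> c False n \<otimes> c True n)
    = (1 / (q - inverse q)) \<odot> (k_gen n \<ominus> k_gen_inv n)"
proof -
  define a b where "a = c True n \<otimes> c False n" and "b = c False n \<otimes> c True n"
  have in_A [simp]: "a \<in> carrier A" "b \<in> carrier A"
    using n by (simp_all add: a_def b_def)
  have vw: "v n = a \<oplus> inverse q \<odot> b" "w n = a \<oplus> q \<odot> b"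
    using c_c_v[of n] c_c_w[of n] n by (simp_all add: a_def b_def)
  have q': "inverse (iu * qh) = - (iu * inverse qh)"
    by (rule inverse_unique) (simp add: iu_square field_simps)
  have q_qh: "iu * qh * inverse q = iu * inverse qh" "iu * inverse qh * q = iu * qh"
    by (simp_all add: field_simps flip: qh_square)
  have "k_gen n \<ominus> k_gen_inv n = (iu * qh) \<odot> v n \<oplus> (iu * inverse qh) \<odot> w n"
    using n minus_smult[of "w n" "iu * inverse qh"]
    by (simp add: k_gen_def k_gen_inv_def q' minus_eq del: inverse_mult_distrib)
  also have "\<dots> = (iu * qh) \<odot> a \<oplus> (iu * inverse qh) \<odot> b \<oplus> ((iu * inverse qh) \<odot> a \<oplus> (iu * qh) \<odot> b)"
    by (simp add: vw smult_add smult_smult q_qh)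
  also have "\<dots> = (iu * (qh + inverse qh)) \<odot> (a \<oplus> b)"
    by (simp add: smult_add add_smult distrib_left a_ac)
  finally have "k_gen n \<ominus> k_gen_inv n = (iu * (qh + inverse qh)) \<odot> (a \<oplus> b)" .
  moreover have cancel: "1 / (d * s) * (u * s) = u / d" if "d * s \<noteq> 0" for d s u :: qfield
    using that by simp
  moreover have "(qh - inverse qh) * (qh + inverse qh) = q - inverse q"
    by (simp add: algebra_simps flip: qh_square)
  then have "1 / (q - inverse q) * (iu * (qh + inverse qh)) = iu / (qh - inverse qh)"
    using q_neq_inverse by (metis cancel right_minus_eq)
  ultimately show ?thesis
    by (simp add: smult_smult flip: a_def b_def)
qed

text \<open>
  \<open>Ad\<close> of \<open>e\<^sub>i\<close> conjugates by \<open>k\<^sub>i\<close>, and \<open>Ad\<close> of \<open>f\<^sub>i\<close> by its inverse. With this choice the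
  weights agree in both cases.
\<close>

definition serre_conjugator :: "bool \<Rightarrow> nat \<Rightarrow> 'a" where
  "serre_conjugator b i = (if b then k_gen i else k_gen_inv i)"

lemma serre_conjugator_root_vector:
  assumes i: "i \<in> {1..n}" and j: "j \<in> {1..n}"
  shows "serre_conjugator b i \<otimes> root_vector b j \<otimes> serre_conjugator (\<not> b) i = (qi n i powi cartan n i j) \<odot> root_vector b j"
proof (cases b)
  case True
  then show ?thesis using k_gen_root_vector[OF i j, of True] by (simp add: serre_conjugator_def)
next
  case False
  have "k_gen_inv i \<otimes> root_vector False j \<otimes> k_gen i = inverse (qi n i powi (- cartan n i j)) \<odot> root_vector False j"
    by (rule conj_inverse) (use i j k_gen_root_vector[OF i j, of False] in \<open>auto simp: k_gen_inverse qi_def\<close>)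
  with False show ?thesis by (simp add: serre_conjugator_def power_int_minus)
qed

text \<open>
  The three degrees of the Serre relations. For degree one the root vectors commute and the
  weight is \<open>1\<close>; degrees two and three follow from the twofold application of the twisted
  commutator, by the vanishing of \<open>e \<otimes> x \<otimes> e\<close> and of \<open>e \<otimes> e\<close>.
\<close>

lemma serre_relations:
  assumes i: "i \<in> {1..n}" and j: "j \<in> {1..n}" and "i \<noteq> j"
    and e: "e = s \<odot> root_vector b i" and x: "x = t \<odot> root_vector b j"
  shows "cartan n i j = 0 \<Longrightarrow> twisted_ad e (serre_conjugator b i) (serre_conjugator (\<not> b) i) 1 x = \<zero>"
    and "cartan n i j = - 1 \<Longrightarrow>
      twisted_ad e (serre_conjugator b i) (serre_conjugator (\<not> b) i) s1 (twisted_ad e (serre_conjugator b i) (serre_conjugator (\<not> b) i) s0 x) = \<zero>"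
    and "twisted_ad e (serre_conjugator b i) (serre_conjugator (\<not> b) i) s2
      (twisted_ad e (serre_conjugator b i) (serre_conjugator (\<not> b) i) s1 (twisted_ad e (serre_conjugator b i) (serre_conjugator (\<not> b) i) s0 x)) = \<zero>"
proof -
  have k: "serre_conjugator b i \<in> carrier A" "serre_conjugator (\<not> b) i \<in> carrier A"
    using i by (simp_all add: serre_conjugator_def)
  have kk': "serre_conjugator (\<not> b) i \<otimes> serre_conjugator b i = \<one>"
    using i by (simp add: serre_conjugator_def k_gen_inverse)
  have in_A: "e \<in> carrier A" "x \<in> carrier A"
    using i j by (simp_all add: e x)
  have wt_x: "serre_conjugator b i \<otimes> x \<otimes> serre_conjugator (\<not> b) i = (qi n i powi cartan n i j) \<odot> x"
    and wt_e: "serre_conjugator b i \<otimes> e \<otimes> serre_conjugator (\<not> b) i = (qi n i powi cartan n i i) \<odot> e"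
    using i j k serre_conjugator_root_vector[OF i j, of b] serre_conjugator_root_vector[OF i i, of b]
    by (simp_all add: e x smult_mult_left smult_mult_right smult_smult mult.commute)
  have ee: "e \<otimes> e = \<zero>"
    using i root_vector_square[OF i, of b] by (simp add: e smult_mult_left smult_mult_right smult_smult)
  note ctx = in_A(1) k in_A(2) kk' wt_x wt_e ee
  show "twisted_ad e (serre_conjugator b i) (serre_conjugator (\<not> b) i) s2
      (twisted_ad e (serre_conjugator b i) (serre_conjugator (\<not> b) i) s1 (twisted_ad e (serre_conjugator b i) (serre_conjugator (\<not> b) i) s0 x)) = \<zero>"
    by (rule twisted_ad_thrice[OF ctx])
  show "twisted_ad e (serre_conjugator b i) (serre_conjugator (\<not> b) i) 1 x = \<zero>" if c: "cartan n i j = 0"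
  proof -
    have "i + 1 < j \<or> j + 1 < i"
      using c \<open>i \<noteq> j\<close> by (auto simp: cartan_def split: if_splits)
    then have "e \<otimes> x = x \<otimes> e"
      using i j root_vector_commute[OF i j, of b b]
      by (simp add: e x smult_mult_left smult_mult_right smult_smult mult.commute)
    then show ?thesis
      using c in_A by (simp add: twisted_ad_def wt_x minus_eq r_neg)
  qed
  show "twisted_ad e (serre_conjugator b i) (serre_conjugator (\<not> b) i) s1 (twisted_ad e (serre_conjugator b i) (serre_conjugator (\<not> b) i) s0 x) = \<zero>"
    if c: "cartan n i j = - 1"
  proof -
    have ij: "j = i + 1 \<or> i = j + 1" "i \<noteq> n"
      using c j \<open>i \<noteq> j\<close> by (auto simp: cartan_def split: if_splits)
    have "e \<otimes> x \<otimes> e = \<zero>"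
      using i j root_vector_sandwich[OF i j ij, of b]
      by (simp add: e x smult_mult_left smult_mult_right smult_smult)
    then show ?thesis
      by (simp add: twisted_ad_twice[OF ctx])
  qed
qed

end

section \<open>The homomorphism to the deformed Clifford algebra\<close>

abbreviation clifford_letter :: "nat \<Rightarrow> bool \<Rightarrow> nat \<Rightarrow> cl_free set" where
  "clifford_letter n b i \<equiv> cl_class n (if b then Psi i else Psid i)"

lemma assoc_algebra_Cl: "assoc_algebra (Cl n)"
  unfolding Cl_def by (rule cl.assoc_algebra_presented)

lemma cl_class_closed: "g \<in> cl_gens n \<Longrightarrow> cl_class n g \<in> carrier (Cl n)"
  unfolding cl_class_def Cl_def by (rule cl.gen_class_closed)

text \<open>
  Each condition on a Clifford system is one defining relation, read in the quotient.
\<close>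

lemma clifford_system_Cl:
  "clifford_system (Cl n) n (clifford_letter n) (\<lambda>i. cl_class n (V i)) (\<lambda>i. cl_class n (Vinv i))"
proof -
  interpret assoc_algebra "Cl n"
    by (rule assoc_algebra_Cl)
  note rel = cl.relation_holds[of n]
  note ops = cl.coset_ops[folded Cl_def cl_class_def]
  show ?thesis
  proof
    fix i j b b' assume i: "i \<in> {1..n}"
    show "clifford_letter n b i \<in> carrier (Cl n)" "cl_class n (V i) \<in> carrier (Cl n)"
      "cl_class n (Vinv i) \<in> carrier (Cl n)"
      using i by (auto intro: cl_class_closed)
    show "cl_class n (V i) \<otimes>\<^bsub>Cl n\<^esub> cl_class n (Vinv i) = \<one>\<^bsub>Cl n\<^esub>"
      using rel[OF cl_rel.V_Vinv[OF i]] i by (simp add: ops)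
    show "cl_class n (Vinv i) \<otimes>\<^bsub>Cl n\<^esub> cl_class n (V i) = \<one>\<^bsub>Cl n\<^esub>"
      using rel[OF cl_rel.Vinv_V[OF i]] i by (simp add: ops)
    show "clifford_letter n True i \<otimes>\<^bsub>Cl n\<^esub> clifford_letter n False i \<oplus>\<^bsub>Cl n\<^esub>
        q \<odot>\<^bsub>Cl n\<^esub> (clifford_letter n False i \<otimes>\<^bsub>Cl n\<^esub> clifford_letter n True i) = cl_class n (Vinv i)"
      using rel[OF cl_rel.Psi_Psid_q[OF i]] i by (simp add: ops)
    show "clifford_letter n True i \<otimes>\<^bsub>Cl n\<^esub> clifford_letter n False i \<oplus>\<^bsub>Cl n\<^esub>
        inverse q \<odot>\<^bsub>Cl n\<^esub> (clifford_letter n False i \<otimes>\<^bsub>Cl n\<^esub> clifford_letter n True i) = cl_class n (V i)"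
      using rel[OF cl_rel.Psi_Psid_q_inv[OF i]] i by (simp add: ops)
    assume j: "j \<in> {1..n}"
    show "cl_class n (V i) \<otimes>\<^bsub>Cl n\<^esub> cl_class n (V j) = cl_class n (V j) \<otimes>\<^bsub>Cl n\<^esub> cl_class n (V i)"
      using rel[OF cl_rel.V_V[OF i j]] i j by (simp add: ops)
    show "cl_class n (V i) \<otimes>\<^bsub>Cl n\<^esub> clifford_letter n b j \<otimes>\<^bsub>Cl n\<^esub> cl_class n (Vinv i) =
        (if i = j then if b then q else inverse q else 1) \<odot>\<^bsub>Cl n\<^esub> clifford_letter n b j"
      using rel[OF cl_rel.V_Psi[OF i j]] rel[OF cl_rel.V_Psid[OF i j]] i j
      by (cases b) (simp_all add: ops)
    assume "i \<noteq> j \<or> b = b'"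
    then show "clifford_letter n b i \<otimes>\<^bsub>Cl n\<^esub> clifford_letter n b' j \<oplus>\<^bsub>Cl n\<^esub>
        clifford_letter n b' j \<otimes>\<^bsub>Cl n\<^esub> clifford_letter n b i = \<zero>\<^bsub>Cl n\<^esub>"
      using rel[OF cl_rel.Psi_Psi[OF i j]] rel[OF cl_rel.Psid_Psid[OF i j]]
        rel[OF cl_rel.Psi_Psid[OF i j]] rel[OF cl_rel.Psi_Psid[OF j i]] i j
      by (cases b; cases b')
        (auto simp: ops a_comm cl_class_closed)
  qed
qed

interpretation Cl: clifford_system "Cl n" n "clifford_letter n"
    "\<lambda>i. cl_class n (V i)" "\<lambda>i. cl_class n (Vinv i)" for n
  by (rule clifford_system_Cl)

lemma osp_gens_iff [simp]:
  "E i \<in> osp_gens n \<longleftrightarrow> i \<in> {1..n}" "F i \<in> osp_gens n \<longleftrightarrow> i \<in> {1..n}"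
  "K i \<in> osp_gens n \<longleftrightarrow> i \<in> {1..n}" "Kinv i \<in> osp_gens n \<longleftrightarrow> i \<in> {1..n}"
  by (auto simp: osp_gens_def)

text \<open>
  Signs in the free algebra are turned into scalars, which evaluation respects.
\<close>

lemma sign_mult: "(- 1) ^ m * p = pm_scale ((- 1) ^ m) (p :: ('g, 'k::field) free_alg)"
  by (cases "even m") (simp_all)

lemma parity_gen: "parity n (gen g) = gen_parity n g"
proof -
  have "gen_parity n g mod 2 = gen_parity n g"
    by (cases g) auto
  then show ?thesis
    unfolding parity_def by (intro Least_equality) (auto simp: homogeneous_def gen_def)
qed

lemma Ad_closed [simp]:
  assumes "i \<in> {1..n}" "x \<in> carrier (free_algebra (osp_gens n))"
  shows "Ad_E n i x \<in> carrier (free_algebra (osp_gens n))"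
    and "Ad_F n i x \<in> carrier (free_algebra (osp_gens n))"
  using assms by (auto simp: Ad_E_def Ad_F_def sign_mult)

lemma Ad_power_closed [simp]:
  assumes "i \<in> {1..n}" "x \<in> carrier (free_algebra (osp_gens n))"
  shows "(Ad_E n i ^^ m) x \<in> carrier (free_algebra (osp_gens n))"
    and "(Ad_F n i ^^ m) x \<in> carrier (free_algebra (osp_gens n))"
  by (induction m) (use assms in \<open>auto simp del: atLeastAtMost_iff\<close>)

lemma presentation_osp: "presentation (osp_gens n) (osp_rel n)"
proof
  fix a b assume "osp_rel n a b"
  then show "a \<in> carrier (free_algebra (osp_gens n)) \<and> b \<in> carrier (free_algebra (osp_gens n))"
    by cases (auto simp: sign_mult)
qed

interpretation osp: presentation "osp_gens n" "osp_rel n" for n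
  by (rule presentation_osp)

text \<open>
  The scalar \<open>- 1\<close> for \<open>f\<^sub>i\<close> comes from the order of the factors in \<open>\<psi>\<^sub>i\<^sub>+\<^sub>1\<psi>\<^sub>i\<^sup>\<dagger>\<close>.
\<close>

lemma pi_gen_root_vector:
  assumes "i \<in> {1..n}"
  shows "pi_gen n (E i) = (if i = n then iu / (qh - inverse qh) else 1) \<odot>\<^bsub>Cl n\<^esub> Cl.root_vector n True i"
    and "pi_gen n (F i) = (if i = n then 1 else - 1) \<odot>\<^bsub>Cl n\<^esub> Cl.root_vector n False i"
    and "pi_gen n (K i) = Cl.k_gen n i"
    and "pi_gen n (Kinv i) = Cl.k_gen_inv n i"
proof -
  have closed: "clifford_letter n b j \<in> carrier (Cl n)" if "j \<in> {1..n}" for b j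
    using that by (rule Cl.c_closed)
  show "pi_gen n (E i) = (if i = n then iu / (qh - inverse qh) else 1) \<odot>\<^bsub>Cl n\<^esub> Cl.root_vector n True i"
    using assms closed[of i True] closed[of n True] closed[of "i + 1" False]
    by (simp add: Cl.root_vector_def Cl.root_letters_def)
  show "pi_gen n (F i) = (if i = n then 1 else - 1) \<odot>\<^bsub>Cl n\<^esub> Cl.root_vector n False i"
    using assms closed[of i False] closed[of n False] closed[of "i + 1" True]
      Cl.letters_swap[of "i + 1" n i True False]
    by (simp add: Cl.root_vector_def Cl.root_letters_def)
qed (simp_all add: Cl.k_gen_def Cl.k_gen_inv_def)

lemma pi_gen_closed: "pi_gen n \<in> osp_gens n \<rightarrow> carrier (Cl n)"
proof
  fix g assume "g \<in> osp_gens n"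
  then show "pi_gen n g \<in> carrier (Cl n)"
    by (cases g) (simp_all add: pi_gen_root_vector del: pi_gen.simps atLeastAtMost_iff)
qed

lemma free_eval_Ad:
  assumes i: "i \<in> {1..n}" and x: "x \<in> carrier (free_algebra (osp_gens n))"
  shows "free_eval (Cl n) (pi_gen n) (Ad_E n i x) = assoc_algebra.twisted_ad (Cl n)
      (pi_gen n (E i)) (Cl.serre_conjugator n True i) (Cl.serre_conjugator n False i)
      ((- 1) ^ (parity n (gen (E i)) * parity n x)) (free_eval (Cl n) (pi_gen n) x)"
    and "free_eval (Cl n) (pi_gen n) (Ad_F n i x) = assoc_algebra.twisted_ad (Cl n)
      (pi_gen n (F i)) (Cl.serre_conjugator n False i) (Cl.serre_conjugator n True i)
      ((- 1) ^ (parity n (gen (F i)) * parity n x)) (free_eval (Cl n) (pi_gen n) x)"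
  using i x
  by (simp_all add: Ad_E_def Ad_F_def sign_mult Cl.twisted_ad_def Cl.serre_conjugator_def
      Cl.free_eval_partial[OF pi_gen_closed] pi_gen_root_vector(3,4)[OF i] del: pi_gen.simps)

lemma cartan_cases: "i \<noteq> j \<Longrightarrow> cartan n i j = 0 \<or> cartan n i j = - 1 \<or> cartan n i j = - 2"
  by (simp add: cartan_def)

text \<open>
  For \<open>i \<noteq> j\<close> the images of \<open>e\<^sub>i\<close> and \<open>f\<^sub>j\<close> commute: they have disjoint sites or both products
  vanish. The supercommutator is an anticommutator only for \<open>i = j = n\<close>, where both generators
  are odd.
\<close>

lemma osp_relations_in_Cl:
  assumes "osp_rel n a b"
  shows "free_eval (Cl n) (pi_gen n) a = free_eval (Cl n) (pi_gen n) b"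
proof -
  note ev = Cl.free_eval_partial[OF pi_gen_closed]
  from assms show ?thesis
  proof cases
    case (K_Kinv i)
    then show ?thesis
      by (simp add: ev pi_gen_root_vector Cl.k_gen_inverse del: pi_gen.simps)
  next
    case (Kinv_K i)
    then show ?thesis
      by (simp add: ev pi_gen_root_vector Cl.k_gen_inverse del: pi_gen.simps)
  next
    case (K_K i j)
    then show ?thesis
      using Cl.k_gen_commute[of i n j] by (simp add: ev pi_gen_root_vector del: pi_gen.simps)
  next
    case (K_E i j)
    then show ?thesis
      using Cl.k_gen_root_vector[of i n j True]
      by (simp add: ev pi_gen_root_vector Cl.smult_mult_left Cl.smult_mult_right Cl.smult_smult
          mult.commute del: pi_gen.simps)
  next
    case (K_F i j)
    then show ?thesis
      using Cl.k_gen_root_vector[of i n j False]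
      by (simp add: ev pi_gen_root_vector Cl.smult_mult_left Cl.smult_mult_right Cl.smult_smult
          mult.commute del: pi_gen.simps)
  next
    case (E_F i j)
    have closed: "clifford_letter n b j \<in> carrier (Cl n)" if "j \<in> {1..n}" for b j
      using that by (rule Cl.c_closed)
    consider "i \<noteq> j" | "i = j" "i \<noteq> n" | "i = n" "j = n"
      by blast
    then show ?thesis
    proof cases
      case 1
      have sign: "gen_parity n (E i) * gen_parity n (F j) = 0"
        using 1 by simp
      have "Cl.root_vector n True i \<otimes>\<^bsub>Cl n\<^esub> Cl.root_vector n False j
          = Cl.root_vector n False j \<otimes>\<^bsub>Cl n\<^esub> Cl.root_vector n True i"
      proof (cases "j = i + 1 \<or> i = j + 1")
        case True
        then show ?thesis
          using Cl.root_vector_opposite_zero[OF E_F(3,4), of True]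
            Cl.root_vector_opposite_zero[OF E_F(4,3), of False] by auto
      next
        case False
        with 1 have "i + 1 < j \<or> j + 1 < i"
          by linarith
        then show ?thesis
          by (rule Cl.root_vector_commute[OF E_F(3,4)])
      qed
      with 1 E_F show ?thesis
        unfolding E_F(1,2) parity_gen sign
        by (simp add: ev pi_gen_root_vector Cl.smult_mult_left Cl.smult_mult_right Cl.smult_smult
            mult.commute Cl.minus_eq Cl.r_neg del: pi_gen.simps)
    next
      case 2
      with E_F Cl.even_commutator[of i n] closed[of i True] closed[of i False]
        closed[of "i + 1" True] closed[of "i + 1" False]
      show ?thesis
        unfolding E_F(1,2) parity_gen
        by (simp add: ev pi_gen_root_vector(3,4) del: pi_gen.simps(3,4))
    next
      case 3
      with E_F Cl.odd_commutator[of n] closed[of n True] closed[of n False]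
      show ?thesis
        unfolding E_F(1,2) parity_gen
        by (simp add: ev pi_gen_root_vector(3,4) Cl.smult_mult_left Cl.smult_mult_right
            Cl.smult_smult Cl.smult_add Cl.minus_smult Cl.minus_eq del: pi_gen.simps(3,4))
    qed
  next
    case (Serre_E i j)
    note rel = Cl.serre_relations[OF Serre_E(3-5), OF pi_gen_root_vector(1)[OF Serre_E(3)]
        pi_gen_root_vector(1)[OF Serre_E(4)]]
    from cartan_cases[OF Serre_E(5)] consider "cartan n i j = 0" | "cartan n i j = - 1" | "cartan n i j = - 2"
      by blast
    then show ?thesis
    proof cases
      case 1
      have "(- 1 :: qfield) ^ (parity n (gen (E i)) * parity n (gen (E j))) = 1"
        using Serre_E by (auto simp: parity_gen)
      with 1 rel(1) show ?thesis
        using Serre_E by (simp add: ev free_eval_Ad del: pi_gen.simps)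
    next
      case 2
      with rel(2) show ?thesis
        using Serre_E by (simp add: ev free_eval_Ad numeral_2_eq_2 del: pi_gen.simps)
    next
      case 3
      with rel(3) show ?thesis
        using Serre_E by (simp add: ev free_eval_Ad numeral_3_eq_3 del: pi_gen.simps)
    qed
  next
    case (Serre_F i j)
    note rel = Cl.serre_relations[OF Serre_F(3-5), OF pi_gen_root_vector(2)[OF Serre_F(3)]
        pi_gen_root_vector(2)[OF Serre_F(4)]]
    from cartan_cases[OF Serre_F(5)] consider "cartan n i j = 0" | "cartan n i j = - 1" | "cartan n i j = - 2"
      by blast
    then show ?thesis
    proof cases
      case 1
      have "(- 1 :: qfield) ^ (parity n (gen (F i)) * parity n (gen (F j))) = 1"
        using Serre_F by (auto simp: parity_gen)
      with 1 rel(1) show ?thesis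
        using Serre_F by (simp add: ev free_eval_Ad del: pi_gen.simps)
    next
      case 2
      with rel(2) show ?thesis
        using Serre_F by (simp add: ev free_eval_Ad numeral_2_eq_2 del: pi_gen.simps)
    next
      case 3
      with rel(3) show ?thesis
        using Serre_F by (simp add: ev free_eval_Ad numeral_3_eq_3 del: pi_gen.simps)
    qed
  qed
qed

interpretation pi: respectful_valuation "osp_gens n" "osp_rel n" "Cl n" "pi_gen n" for n
  by unfold_locales (auto simp: osp_relations_in_Cl intro: funcset_mem[OF pi_gen_closed])

lemma spinor_hom_class: "g \<in> osp_gens n \<Longrightarrow> spinor_hom n (osp_class n g) = pi_gen n g"
  unfolding spinor_hom_def osp_class_def by (rule pi.induced_hom_gen_class)

lemma spinor_hom_algebra_hom: "spinor_hom n \<in> algebra_hom (Uq_osp n) (Cl n)"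
  unfolding spinor_hom_def Uq_osp_def by (rule pi.induced_hom_algebra_hom)

lemma osp_class_closed: "g \<in> osp_gens n \<Longrightarrow> osp_class n g \<in> carrier (Uq_osp n)"
  unfolding osp_class_def Uq_osp_def by (rule osp.gen_class_closed)

lemma representation_spinor: "representation (Uq_osp n) (fock_space n) (spinor_rep n)"
  using algebra_hom_comp[OF spinor_hom_algebra_hom fock_rep_algebra_hom, of n]
  by (simp add: representation_def subspace_fock_space spinor_rep_def[abs_def])

section \<open>The action on the kets\<close>

lemma fock_rep_ops:
  assumes "x \<in> carrier (Cl n)" "v \<in> fock_space n"
  shows "y \<in> carrier (Cl n) \<Longrightarrow> fock_rep n (x \<otimes>\<^bsub>Cl n\<^esub> y) v = fock_rep n x (fock_rep n y v)"
    and "fock_rep n (c \<odot>\<^bsub>Cl n\<^esub> x) v = pm_scale c (fock_rep n x v)"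
  using fock_rep_algebra_hom[of n] assms
  by (auto simp: algebra_hom_def ring_hom_def compose_def)

lemma spinor_action:
  assumes i: "i \<in> {1..n}" and v: "v \<in> fock_space n"
  shows "spinor_rep n (osp_class n (E i)) v =
      (if i = n then pm_scale (iu / (qh - inverse qh)) (flip n 1 n v)
       else flip n 1 i (flip n 0 (i + 1) v))"
    and "spinor_rep n (osp_class n (F i)) v =
      (if i = n then flip n 0 n v else flip n 1 (i + 1) (flip n 0 i v))"
    and "spinor_rep n (osp_class n (K i)) v =
      (if i = n then pm_scale (iu * qh) (cl_action n (V n) v)
       else cl_action n (V i) (cl_action n (Vinv (i + 1)) v))"
proof -
  have closed: "cl_class n (Psi j) \<in> carrier (Cl n)" "cl_class n (Psid j) \<in> carrier (Cl n)"
    "cl_class n (V j) \<in> carrier (Cl n)" "cl_class n (Vinv j) \<in> carrier (Cl n)"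
    if "j \<in> {1..n}" for j
    using that by (simp_all add: cl_class_closed)
  have "i + 1 \<in> {1..n}" if "i \<noteq> n"
    using that i by auto
  then show "spinor_rep n (osp_class n (E i)) v =
      (if i = n then pm_scale (iu / (qh - inverse qh)) (flip n 1 n v)
       else flip n 1 i (flip n 0 (i + 1) v))"
    and "spinor_rep n (osp_class n (F i)) v =
      (if i = n then flip n 0 n v else flip n 1 (i + 1) (flip n 0 i v))"
    and "spinor_rep n (osp_class n (K i)) v =
      (if i = n then pm_scale (iu * qh) (cl_action n (V n) v)
       else cl_action n (V i) (cl_action n (Vinv (i + 1)) v))"
    using i v closed
    by (auto simp: spinor_rep_def spinor_hom_class fock_rep_ops fock_rep_class cl_action_flip
        simp del: cl_action.simps)
qed

section \<open>Highest weight vector and dimension\<close>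

lemma highest_weight_vacuum:
  "highest_weight_vector n (fock_space n) (spinor_rep n) (\<lambda>i. if i = n then iu * qh else 1) (vacuum n)"
proof -
  define r where "r = (\<lambda>i\<in>{1..n}. 0 :: nat)"
  have r: "r \<in> occupation n" and empty: "\<And>i. i \<in> {1..n} \<Longrightarrow> r i = 0"
    by (auto simp: r_def occupation_def)
  show ?thesis
    unfolding highest_weight_vector_def vacuum_def r_def[symmetric]
  proof (intro conjI ballI)
    show "ket r \<in> fock_space n"
      using r by simp
    show "ket r \<noteq> 0"
      by (metis ket_def lookup_single_eq lookup_zero zero_neq_one)
    fix i assume i: "i \<in> {1..n}"
    have "flip n 1 i (flip n 0 (i + 1) (ket r)) = 0" if "i \<noteq> n"
    proof -
      have i': "i + 1 \<in> {1..n}" using i that by auto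
      then have "r(i + 1 := 1) \<in> occupation n"
        using r by simp
      then show ?thesis
        using i i' r empty by (simp add: flip_ket flip_linear)
    qed
    then show "spinor_rep n (osp_class n (E i)) (ket r) = 0"
      using i r empty by (auto simp: spinor_action flip_ket)
    show "spinor_rep n (osp_class n (K i)) (ket r) = pm_scale (if i = n then iu * qh else 1) (ket r)"
      using i r empty by (auto simp: spinor_action cl_action_V_ket simp del: cl_action.simps)
  qed
qed

lemma card_occupation: "card (occupation n) = 2 ^ n"
  by (simp add: occupation_def card_PiE numeral_2_eq_2)

text \<open>
  The kets form a basis, one for each function from \<open>{1..n}\<close> to \<open>{0, 1}\<close>.
\<close>

lemma dim_fock_space: "pm.dim (fock_space n) = 2 ^ n"
proof -
  have lookup_ket: "Poly_Mapping.lookup (ket r) s = (if r = s then 1 else 0)" for r s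
    by (simp add: ket_def lookup_single when_def)
  then have ket_eq: "ket r = ket s \<longleftrightarrow> r = s" for r s
    by (metis zero_neq_one)
  then have inj: "inj_on ket (occupation n)"
    by (simp add: inj_on_def)
  have "pm.independent (ket ` occupation n)"
    unfolding pm.independent_explicit_finite_subsets
  proof safe
    fix S u x assume S: "S \<subseteq> ket ` occupation n" "finite S"
      and 0: "(\<Sum>v\<in>S. pm_scale (u v) v) = 0" and x: "x \<in> S"
    obtain r where r: "x = ket r" using S x by auto
    have "0 = (\<Sum>v\<in>S. u v * Poly_Mapping.lookup v r)"
      using arg_cong[OF 0, of "\<lambda>v. Poly_Mapping.lookup v r"] by (simp add: lookup_sum)
    also have "\<dots> = (\<Sum>v\<in>S. if v = x then u v else 0)"
    proof (rule sum.cong[OF refl])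
      fix v assume "v \<in> S"
      then obtain s where "v = ket s" using S by blast
      then show "u v * Poly_Mapping.lookup v r = (if v = x then u v else 0)"
        by (simp add: r lookup_ket ket_eq)
    qed
    also have "\<dots> = u x"
      using S x by simp
    finally show "u x = 0" by simp
  qed
  moreover have "fock_space n \<subseteq> pm.span (ket ` occupation n)"
  proof
    fix v assume "v \<in> fock_space n"
    then show "v \<in> pm.span (ket ` occupation n)"
      by (subst fock_expansion) (auto intro: pm.span_sum pm.span_scale pm.span_base)
  qed
  ultimately have "pm.dim (fock_space n) = card (ket ` occupation n)"
    by (intro pm.dim_unique) auto
  then show ?thesis
    using inj by (simp add: card_image card_occupation)
qed

section \<open>Irreducibility\<close>

text \<open>
  On Fock space the projections \<open>\<psi>\<^sub>i\<psi>\<^sub>i\<^sup>\<dagger>\<close> and \<open>\<psi>\<^sub>i\<^sup>\<dagger>\<psi>\<^sub>i\<close> sum to the identity. In the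
  deformed Clifford algebra itself the sum is not \<open>1\<close>: it maps to \<open>- 1\<close> under the twist of Fock
  space by the automorphism with \<open>v\<^sub>i \<mapsto> - v\<^sub>i\<close>, \<open>\<psi>\<^sub>i \<mapsto> - \<psi>\<^sub>i\<close>, \<open>\<psi>\<^sub>i\<^sup>\<dagger> \<mapsto> \<psi>\<^sub>i\<^sup>\<dagger>\<close>.
\<close>

lemma flip_complete:
  assumes i: "i \<in> {1..n}" and v: "v \<in> fock_space n"
  shows "flip n 0 i (flip n 1 i v) + flip n 1 i (flip n 0 i v) = v"
proof -
  let ?B = "End_algebra (fock_space n)"
  let ?T = "(flip n 0 i \<otimes>\<^bsub>?B\<^esub> flip n 1 i) \<oplus>\<^bsub>?B\<^esub> (flip n 1 i \<otimes>\<^bsub>?B\<^esub> flip n 0 i)"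
  have "?T = \<one>\<^bsub>?B\<^esub>"
  proof (rule End_fock_eqI)
    show "?T \<in> carrier ?B" "\<one>\<^bsub>?B\<^esub> \<in> carrier ?B"
      using i by (auto intro!: fock.a_closed fock.m_closed fock.one_closed flip_closed simp del: End_algebra_simps)
    fix r assume r: "r \<in> occupation n"
    show "?T (ket r) = \<one>\<^bsub>?B\<^esub> (ket r)"
      using flip_twice(2)[OF i _ r, of 0] flip_twice(2)[OF i _ r, of 1] occupation_cases[OF r i] r
      by (auto simp: compose_def)
  qed
  from fun_cong[OF this, of v] v show ?thesis
    by (simp add: compose_def)
qed

lemma flip_anticommute_all:
  assumes i: "i \<in> {1..n}" and j: "j \<in> {1..n}" and "i \<noteq> j"
    and b: "b = 0 \<or> b = 1" and c: "c = 0 \<or> c = 1" and v: "v \<in> fock_space n"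
  shows "flip n b i (flip n c j v) + flip n c j (flip n b i v) = 0"
proof -
  let ?B = "End_algebra (fock_space n)"
  let ?T = "(flip n b i \<otimes>\<^bsub>?B\<^esub> flip n c j) \<oplus>\<^bsub>?B\<^esub> (flip n c j \<otimes>\<^bsub>?B\<^esub> flip n b i)"
  have "?T = \<zero>\<^bsub>?B\<^esub>"
  proof (rule End_fock_eqI)
    show "?T \<in> carrier ?B" "\<zero>\<^bsub>?B\<^esub> \<in> carrier ?B"
      using i j b c by (auto intro!: fock.a_closed fock.m_closed fock.zero_closed flip_closed simp del: End_algebra_simps)
    fix r assume r: "r \<in> occupation n"
    show "?T (ket r) = \<zero>\<^bsub>?B\<^esub> (ket r)"
      using flip_anticommute[OF i j \<open>i \<noteq> j\<close> b c r] r by (simp add: compose_def)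
  qed
  from fun_cong[OF this, of v] v show ?thesis
    by (simp add: compose_def)
qed

locale invariant_subspace =
  fixes n :: nat and W :: "fock set"
  assumes subspace: "pm.subspace W" and in_fock: "W \<subseteq> fock_space n"
    and invariant: "a \<in> carrier (Uq_osp n) \<Longrightarrow> w \<in> W \<Longrightarrow> spinor_rep n a w \<in> W"
begin

lemma class_invariant: "g \<in> osp_gens n \<Longrightarrow> w \<in> W \<Longrightarrow> spinor_rep n (osp_class n g) w \<in> W"
  by (rule invariant[OF osp_class_closed])

text \<open>
  The last generators \<open>e\<^sub>n\<close> and \<open>f\<^sub>n\<close> act by nonzero multiples of \<open>\<psi>\<^sub>n\<close> and \<open>\<psi>\<^sub>n\<^sup>\<dagger>\<close>.
\<close>

lemma flip_top:
  assumes "n \<ge> 1" "w \<in> W" "b = 0 \<or> b = 1"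
  shows "flip n b n w \<in> W"
proof -
  have w: "w \<in> fock_space n" and n: "n \<in> {1..n}"
    using assms in_fock by auto
  have "flip n 0 n w \<in> W"
    using class_invariant[of "F n" w] assms spinor_action(2)[OF n w] by simp
  moreover have "flip n 1 n w \<in> W"
  proof -
    define s where "s = iu / (qh - inverse qh)"
    have "s \<noteq> 0"
      by (simp add: s_def)
    moreover have "pm_scale s (flip n 1 n w) \<in> W"
      using class_invariant[of "E n" w] n assms(2) unfolding spinor_action(1)[OF n w] s_def
      by simp
    from pm.subspace_scale[OF subspace this, of "inverse s"]
    have "pm_scale (inverse s * s) (flip n 1 n w) \<in> W" by simp
    ultimately show ?thesis by simp
  qed
  ultimately show ?thesis using assms by auto
qed

text \<open>
  Write \<open>\<psi>\<close> for the flip at the site \<open>i\<close>, and \<open>u\<close>, \<open>d\<close> for the two flips at the site \<open>i + 1\<close>, with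
  \<open>du + ud = 1\<close>. Then \<open>\<psi> = (\<psi>d)u + (\<psi>u)d = (\<psi>d)u - u(\<psi>d)\<close>. The pair \<open>\<psi>d\<close> is up to sign the action of
  \<open>e\<^sub>i\<close> or \<open>f\<^sub>i\<close>, and \<open>u\<close> preserves \<open>W\<close> by hypothesis.
\<close>

lemma flip_step:
  assumes i: "i \<in> {1..n}" "i \<noteq> n" and w: "w \<in> W" and b: "b = 0 \<or> b = 1"
    and next_site: "\<And>b w. w \<in> W \<Longrightarrow> b = 0 \<or> b = 1 \<Longrightarrow> flip n b (i + 1) w \<in> W"
  shows "flip n b i w \<in> W"
proof -
  have i': "i + 1 \<in> {1..n}" using i by auto
  have fock: "w \<in> fock_space n" if "w \<in> W" for w
    using that in_fock by auto
  have pair: "flip n b i (flip n (1 - b) (i + 1) w) \<in> W" if "w \<in> W" for w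
  proof -
    have "flip n 1 i (flip n 0 (i + 1) w) \<in> W"
      using class_invariant[of "E i" w] spinor_action(1)[OF i(1) fock] i that by simp
    moreover have "flip n 1 (i + 1) (flip n 0 i w) \<in> W"
      using class_invariant[of "F i" w] spinor_action(2)[OF i(1) fock] i that by simp
    moreover have "flip n 0 i (flip n 1 (i + 1) w) = - flip n 1 (i + 1) (flip n 0 i w)"
      using flip_anticommute_all[OF i(1) i' _ _ _ fock[OF that], of 0 1]
      by (simp add: eq_neg_iff_add_eq_0)
    ultimately have "flip n 1 i (flip n 0 (i + 1) w) \<in> W" "flip n 0 i (flip n 1 (i + 1) w) \<in> W"
      using pm.subspace_neg[OF subspace] by auto
    with b show ?thesis
      by (elim disjE) (simp_all only: diff_zero diff_self_eq_0)
  qed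
  let ?u = "flip n b (i + 1)" and ?d = "flip n (1 - b) (i + 1)"
  have b': "1 - b = 0 \<or> 1 - b = 1" using b by auto
  have u: "?u w \<in> W" using next_site w b by blast
  have "flip n b i w = flip n b i (?d (?u w)) + flip n b i (?u (?d w))"
  proof -
    have closed: "?d (?u w) \<in> fock_space n" "?u (?d w) \<in> fock_space n"
      using i' b b' fock[OF w] by (auto simp: flip_linear(3))
    have "w = ?d (?u w) + ?u (?d w)"
      using flip_complete[OF i' fock[OF w]] b by (auto simp: add.commute)
    then have "flip n b i w = flip n b i (?d (?u w) + ?u (?d w))"
      by simp
    also have "\<dots> = flip n b i (?d (?u w)) + flip n b i (?u (?d w))"
      by (rule End_fock_app(2)[OF flip_closed[OF i(1) b] closed])
    finally show ?thesis .
  qed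
  also have "flip n b i (?u (?d w)) = - ?u (flip n b i (?d w))"
  proof -
    have "?d w \<in> fock_space n"
      using i' b' fock[OF w] by (auto simp: flip_linear(3))
    then show ?thesis
      using flip_anticommute_all[OF i(1) i' _ b b, of "?d w"] by (simp add: eq_neg_iff_add_eq_0)
  qed
  finally have "flip n b i w = flip n b i (?d (?u w)) - ?u (flip n b i (?d w))"
    by simp
  with pair[OF u] next_site[OF pair[OF w] b] show ?thesis
    using pm.subspace_diff[OF subspace] by simp
qed

text \<open>
  Downward induction on the site, starting from the odd generators at the site \<open>n\<close>.
\<close>

lemma flip_invariant:
  assumes "i \<in> {1..n}" "w \<in> W" "b = 0 \<or> b = 1"
  shows "flip n b i w \<in> W"
proof -
  from assms(1) have "i \<le> n" by simp
  then have "i \<ge> 1 \<Longrightarrow> w \<in> W \<Longrightarrow> b = 0 \<or> b = 1 \<Longrightarrow> flip n b i w \<in> W" for b w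
  proof (induction i arbitrary: b w rule: inc_induct)
    case base
    then show ?case by (intro flip_top) auto
  next
    case (step i)
    show ?case
      by (rule flip_step) (use step in auto)
  qed
  with assms show ?thesis by simp
qed

lemma restrict_to_site:
  assumes i: "i \<in> {1..n}" and w: "w \<in> W" and b: "b = 0 \<or> b = 1"
  shows "(\<Sum>r\<in>occupation n. pm_scale (if r i = b then Poly_Mapping.lookup w r else 0) (ket r)) \<in> W"
proof -
  have b': "1 - b = 0 \<or> 1 - b = 1" using b by auto
  let ?B = "End_algebra (fock_space n)"
  let ?P = "flip n (1 - b) i \<otimes>\<^bsub>?B\<^esub> flip n b i"
  have P: "?P \<in> carrier ?B"
    by (intro fock.m_closed flip_closed i b b')
  have wf: "w \<in> fock_space n" using w in_fock by auto
  have "?P w = (\<Sum>r\<in>occupation n. ?P (pm_scale (Poly_Mapping.lookup w r) (ket r)))"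
    by (subst fock_expansion[OF wf]) (rule End_fock_sum[OF P], simp)
  also have "\<dots> = (\<Sum>r\<in>occupation n. pm_scale (if r i = b then Poly_Mapping.lookup w r else 0) (ket r))"
  proof (rule sum.cong[OF refl])
    fix r assume r: "r \<in> occupation n"
    have "?P (ket r) = (if r i = b then ket r else 0)"
      using flip_twice(2)[OF i b r] r by (simp add: compose_def)
    moreover have "?P (pm_scale (Poly_Mapping.lookup w r) (ket r)) = pm_scale (Poly_Mapping.lookup w r) (?P (ket r))"
      by (rule End_fock_app(3)[OF P ket_in_fock[OF r]])
    ultimately show "?P (pm_scale (Poly_Mapping.lookup w r) (ket r))
        = pm_scale (if r i = b then Poly_Mapping.lookup w r else 0) (ket r)"
      by simp
  qed
  finally show ?thesis
    using flip_invariant[OF i flip_invariant[OF i w b] b'] wf by (simp add: compose_def)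
qed

text \<open>
  A nonzero vector of \<open>W\<close> with the fewest kets has only one: if two of its kets differed at a
  site, the projection to one occupation number at that site would leave a shorter nonzero vector
  of \<open>W\<close>.
\<close>

lemma ket_exists:
  assumes "W \<noteq> {0}"
  shows "\<exists>r\<in>occupation n. ket r \<in> W"
proof -
  have "\<exists>w. w \<in> W \<and> w \<noteq> 0"
    using assms pm.subspace_0[OF subspace] by auto
  then obtain w where w: "w \<in> W" "w \<noteq> 0"
    and least: "\<And>u. u \<in> W \<and> u \<noteq> 0 \<Longrightarrow> card (Poly_Mapping.keys w) \<le> card (Poly_Mapping.keys u)"
    using ex_has_least_nat[of "\<lambda>w. w \<in> W \<and> w \<noteq> 0" _ "\<lambda>w. card (Poly_Mapping.keys w)"] by blast
  have wf: "Poly_Mapping.keys w \<subseteq> occupation n"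
    using w in_fock by (auto simp: fock_space_def)
  obtain r where r: "r \<in> Poly_Mapping.keys w"
    using w(2) by (metis keys_eq_empty ex_in_conv)
  have "s = r" if s: "s \<in> Poly_Mapping.keys w" for s
  proof (rule ccontr)
    assume "s \<noteq> r"
    then obtain i where i: "i \<in> {1..n}" "s i \<noteq> r i"
      using PiE_ext[of s "{1..n}" "\<lambda>_. {0, 1}" r] r s wf unfolding occupation_def by blast
    define u where "u = (\<Sum>t\<in>occupation n. pm_scale (if t i = r i then Poly_Mapping.lookup w t else 0) (ket t))"
    have "u \<in> W"
      unfolding u_def using occupation_cases[of r n i] r wf i w(1) by (intro restrict_to_site) auto
    have lookup_u: "Poly_Mapping.lookup u t = (if t i = r i then Poly_Mapping.lookup w t else 0)" for t
    proof -
      have "Poly_Mapping.lookup u t =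
          (\<Sum>t'\<in>occupation n. if t' = t then (if t i = r i then Poly_Mapping.lookup w t else 0) else 0)"
        unfolding u_def lookup_sum by (intro sum.cong) (auto simp: ket_def lookup_single when_def)
      then show ?thesis
        using wf by (auto simp: sum.delta in_keys_iff)
    qed
    have "Poly_Mapping.keys u \<subset> Poly_Mapping.keys w"
      using s i by (auto simp: in_keys_iff lookup_u split: if_splits)
    then have "card (Poly_Mapping.keys u) < card (Poly_Mapping.keys w)"
      by (intro psubset_card_mono) auto
    moreover have "u \<noteq> 0"
      using r by (auto simp: in_keys_iff lookup_u poly_mapping_eq_iff fun_eq_iff intro!: exI[of _ r])
    ultimately show False
      using least[of u] \<open>u \<in> W\<close> by auto
  qed
  then have w_eq: "w = pm_scale (Poly_Mapping.lookup w r) (ket r)"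
    by (intro poly_mapping_eqI) (auto simp: ket_def lookup_single when_def in_keys_iff)
  have "ket r = pm_scale (inverse (Poly_Mapping.lookup w r)) w"
    using r by (subst w_eq) (simp add: in_keys_iff)
  then have "ket r \<in> W"
    using pm.subspace_scale[OF subspace w(1)] by simp
  with r wf show ?thesis by auto
qed

lemma ket_update:
  assumes r: "r \<in> occupation n" "ket r \<in> W" and i: "i \<in> {1..n}" and b: "b = 0 \<or> b = 1"
  shows "ket (r(i := b)) \<in> W"
proof (cases "r i = b")
  case True
  then show ?thesis using r by (simp add: fun_upd_idem)
next
  case False
  then have "r i = 1 - b" "1 - (1 - b) = b"
    using occupation_cases[OF r(1) i] b by auto
  moreover have "flip n (1 - b) i (ket r) \<in> W"
    by (rule flip_invariant[OF i r(2)]) (use b in auto)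
  ultimately have "pm_scale (site_sign i r) (ket (r(i := b))) \<in> W"
    using r by (simp add: flip_ket)
  from pm.subspace_scale[OF subspace this, of "site_sign i r"] show ?thesis
    by simp
qed

text \<open>
  The occupation numbers are changed site by site, from those of \<open>r\<close> to those of \<open>s\<close>.
\<close>

lemma all_kets:
  assumes r: "r \<in> occupation n" "ket r \<in> W" and s: "s \<in> occupation n"
  shows "ket s \<in> W"
proof -
  have "k \<le> n \<Longrightarrow> (\<lambda>i. if i \<in> {1..k} then s i else r i) \<in> occupation n
      \<and> ket (\<lambda>i. if i \<in> {1..k} then s i else r i) \<in> W" for k
  proof (induction k)
    case 0
    then show ?case using r by simp
  next
    case (Suc k)
    let ?f = "\<lambda>i. if i \<in> {1..k} then s i else r i"
    have eq: "(\<lambda>i. if i \<in> {1..Suc k} then s i else r i) = ?f(Suc k := s (Suc k))"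
      by (auto simp: fun_eq_iff)
    have i: "Suc k \<in> {1..n}" using Suc by simp
    show ?case
      unfolding eq using Suc ket_update[of ?f "Suc k"] i occupation_cases[OF s i]
        occupation_update[of ?f n "Suc k"]
      by auto
  qed
  from this[of n] have "ket (\<lambda>i. if i \<in> {1..n} then s i else r i) \<in> W"
    by simp
  moreover have "(\<lambda>i. if i \<in> {1..n} then s i else r i) = s"
    using r(1) s by (intro ext) (auto simp: occupation_def PiE_def extensional_def)
  ultimately show ?thesis by simp
qed

lemma trivial_or_full: "W = {0} \<or> W = fock_space n"
proof (cases "W = {0}")
  case False
  then obtain r where "r \<in> occupation n" "ket r \<in> W"
    using ket_exists by blast
  then have kets: "ket s \<in> W" if "s \<in> occupation n" for s
    using all_kets that by blast
  have "v \<in> W" if "v \<in> fock_space n" for v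
    by (subst fock_expansion[OF that])
      (intro pm.subspace_sum[OF subspace] pm.subspace_scale[OF subspace] kets)
  with in_fock show ?thesis by blast
qed simp

end

theorem proposition2p6:
  fixes n :: nat
  assumes "n \<ge> 1"
  shows "irreducible_representation (Uq_osp n) (fock_space n) (spinor_rep n) \<and>
         highest_weight_vector n (fock_space n) (spinor_rep n)
           (\<lambda>i. if i = n then iu * qh else 1) (vacuum n) \<and>
         pm.dim (fock_space n) = 2 ^ n"
proof (intro conjI)
  have "fock_space n \<noteq> {0}"
    using highest_weight_vacuum[of n] unfolding highest_weight_vector_def by blast
  moreover have "W = {0} \<or> W = fock_space n"
    if "pm.subspace W \<and> W \<subseteq> fock_space n \<and> (\<forall>a\<in>carrier (Uq_osp n). \<forall>w\<in>W. spinor_rep n a w \<in> W)" for W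
  proof -
    interpret invariant_subspace n W
      by unfold_locales (use that in auto)
    show ?thesis by (rule trivial_or_full)
  qed
  ultimately show "irreducible_representation (Uq_osp n) (fock_space n) (spinor_rep n)"
    using representation_spinor[of n] unfolding irreducible_representation_def by blast
qed (rule highest_weight_vacuum dim_fock_space)+

end
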